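(* Let $(R,\mathfrak{m},k)$ be a commutative Noetherian local ring and let $M$ be a finitely generated $R$-module with $\operatorname{depth}_R(M)\geq 1$. Let $t\geq 0$ be an integer. If $\operatorname{Tor}_n^R(\mathfrak{m}^t M, N) = 0$ for some finitely generated $R$-module $N$ and some integer $n\geq 1$, then $\operatorname{Tor}_n^R(M, N) = 0$. Similarly, if $\operatorname{Ext}_R^n(N, \mathfrak{m}^t M) = 0$ for some finitely generated $R$-module $N$ and some integer $n\geq 1$, then $\operatorname{Ext}_R^n(N, M) = 0$.
   Context: Throughout, $R$ is a commutative Noetherian local ring with unique maximal ideal $\mathfrak{m}$ and residue field $k$, and all modules are finitely generated. *)

theory Defs
  imports "HOL-Algebra.Algebra"
begin

definition ring_module :: "'a ring \<Rightarrow> ('a, 'a) module" where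
  "ring_module R = \<lparr>carrier = carrier R, monoid.mult = monoid.mult R, monoid.one = \<one>\<^bsub>R\<^esub>,
     ring.zero = \<zero>\<^bsub>R\<^esub>, ring.add = add R, module.smult = monoid.mult R\<rparr>"

definition vecs :: "('a, 'm) module \<Rightarrow> nat \<Rightarrow> (nat \<Rightarrow> 'm) set" where
  "vecs M b = {u. (\<forall>j<b. u j \<in> carrier M) \<and> (\<forall>j\<ge>b. u j = \<zero>\<^bsub>M\<^esub>)}"

definition lincomb :: "('a, 'm) module \<Rightarrow> (nat \<Rightarrow> 'a) \<Rightarrow> (nat \<Rightarrow> 'm) \<Rightarrow> nat \<Rightarrow> 'm" where
  "lincomb M c x b = (\<Oplus>\<^bsub>M\<^esub> j\<in>{..<b}. c j \<odot>\<^bsub>M\<^esub> x j)"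

text \<open>Action of a q x p matrix A over R on M^p (giving M^q): this is the map
  (R^p \<rightarrow> R^q) \<otimes> M under the identification R^b \<otimes> M = M^b.\<close>
definition mat_act :: "('a, 'm) module \<Rightarrow> (nat \<Rightarrow> nat \<Rightarrow> 'a) \<Rightarrow> nat \<Rightarrow> nat \<Rightarrow> (nat \<Rightarrow> 'm) \<Rightarrow> (nat \<Rightarrow> 'm)" where
  "mat_act M A p q u = (\<lambda>k. if k < q then (\<Oplus>\<^bsub>M\<^esub> j\<in>{..<p}. A k j \<odot>\<^bsub>M\<^esub> u j) else \<zero>\<^bsub>M\<^esub>)"

text \<open>Transposed action of a q x p matrix A on M^q (giving M^p): this is the map
  Hom(R^q, M) \<rightarrow> Hom(R^p, M), phi \<mapsto> phi \<circ> A, under Hom(R^b, M) = M^b.\<close>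
definition mat_tact :: "('a, 'm) module \<Rightarrow> (nat \<Rightarrow> nat \<Rightarrow> 'a) \<Rightarrow> nat \<Rightarrow> nat \<Rightarrow> (nat \<Rightarrow> 'm) \<Rightarrow> (nat \<Rightarrow> 'm)" where
  "mat_tact M A p q phi = (\<lambda>j. if j < p then (\<Oplus>\<^bsub>M\<^esub> k\<in>{..<q}. A k j \<odot>\<^bsub>M\<^esub> phi k) else \<zero>\<^bsub>M\<^esub>)"

text \<open>A free resolution  ... \<rightarrow> R^{b 2} \<rightarrow> R^{b 1} \<rightarrow> R^{b 0} \<rightarrow> M \<rightarrow> 0  of M by finitely
  generated free modules: d i is the b(i-1) x b i matrix of the differential
  R^{b i} \<rightarrow> R^{b (i-1)} (i \<ge> 1), and e j (j < b 0) are the images in M of the standard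
  basis vectors of R^{b 0} under the augmentation.\<close>
definition free_resolution ::
    "'a ring \<Rightarrow> ('a, 'm) module \<Rightarrow> (nat \<Rightarrow> nat) \<Rightarrow> (nat \<Rightarrow> nat \<Rightarrow> nat \<Rightarrow> 'a) \<Rightarrow> (nat \<Rightarrow> 'm) \<Rightarrow> bool" where
  "free_resolution R M b d e \<longleftrightarrow>
     (\<forall>i\<ge>1. \<forall>k<b (i - 1). \<forall>j<b i. d i k j \<in> carrier R) \<and>
     (\<forall>j<b 0. e j \<in> carrier M) \<and>
     (\<forall>x\<in>carrier M. \<exists>c\<in>vecs (ring_module R) (b 0). x = lincomb M c e (b 0)) \<and>
     (\<forall>c\<in>vecs (ring_module R) (b 0).
        lincomb M c e (b 0) = \<zero>\<^bsub>M\<^esub> \<longleftrightarrow>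
        (\<exists>w\<in>vecs (ring_module R) (b 1). c = mat_act (ring_module R) (d 1) (b 1) (b 0) w)) \<and>
     (\<forall>i\<ge>1. \<forall>c\<in>vecs (ring_module R) (b i).
        mat_act (ring_module R) (d i) (b i) (b (i - 1)) c = (\<lambda>_. \<zero>\<^bsub>R\<^esub>) \<longleftrightarrow>
        (\<exists>w\<in>vecs (ring_module R) (b (Suc i)).
            c = mat_act (ring_module R) (d (Suc i)) (b (Suc i)) (b i) w))"

text \<open>Tor_n^R(M, N) = 0 for n \<ge> 1: the n-th homology of F \<otimes> N vanishes, F a free
  resolution of M (independent of the choice of F).  Only meaningful for n \<ge> 1.\<close>
definition Tor_vanishes :: "'a ring \<Rightarrow> nat \<Rightarrow> ('a, 'm) module \<Rightarrow> ('a, 'n) module \<Rightarrow> bool" where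
  "Tor_vanishes R n M N \<longleftrightarrow>
     (\<forall>b d e. free_resolution R M b d e \<longrightarrow>
        (\<forall>u\<in>vecs N (b n). mat_act N (d n) (b n) (b (n - 1)) u = (\<lambda>_. \<zero>\<^bsub>N\<^esub>) \<longrightarrow>
           (\<exists>w\<in>vecs N (b (Suc n)). u = mat_act N (d (Suc n)) (b (Suc n)) (b n) w)))"

text \<open>Ext^n_R(N, M) = 0 for n \<ge> 1: the n-th cohomology of Hom(F, M) vanishes, F a free
  resolution of N.  Only meaningful for n \<ge> 1.\<close>
definition Ext_vanishes :: "'a ring \<Rightarrow> nat \<Rightarrow> ('a, 'n) module \<Rightarrow> ('a, 'm) module \<Rightarrow> bool" where
  "Ext_vanishes R n N M \<longleftrightarrow>
     (\<forall>b d e. free_resolution R N b d e \<longrightarrow>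
        (\<forall>phi\<in>vecs M (b n). mat_tact M (d (Suc n)) (b (Suc n)) (b n) phi = (\<lambda>_. \<zero>\<^bsub>M\<^esub>) \<longrightarrow>
           (\<exists>psi\<in>vecs M (b (n - 1)). phi = mat_tact M (d n) (b n) (b (n - 1)) psi)))"

definition fin_gen :: "'a ring \<Rightarrow> ('a, 'm) module \<Rightarrow> bool" where
  "fin_gen R M \<longleftrightarrow> (\<exists>b e. (\<forall>j<b. e j \<in> carrier M) \<and>
      (\<forall>x\<in>carrier M. \<exists>c\<in>vecs (ring_module R) b. x = lincomb M c e b))"

definition ideal_times :: "('a, 'm) module \<Rightarrow> 'a set \<Rightarrow> 'm set \<Rightarrow> 'm set" where
  "ideal_times M I S = {lincomb M a x k | k a x. \<forall>i<k. a i \<in> I \<and> x i \<in> S}"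

definition pow_submod :: "('a, 'm) module \<Rightarrow> 'a set \<Rightarrow> nat \<Rightarrow> ('a, 'm) module" where
  "pow_submod M I t = M\<lparr>carrier := (ideal_times M I ^^ t) (carrier M)\<rparr>"

definition noetherian_local :: "'a ring \<Rightarrow> 'a set \<Rightarrow> bool" where
  "noetherian_local R m \<longleftrightarrow> cring R \<and> noetherian_ring R \<and> maximalideal m R \<and>
     (\<forall>I. maximalideal I R \<longrightarrow> I = m)"

definition M_regular :: "'a ring \<Rightarrow> ('a, 'm) module \<Rightarrow> 'a \<Rightarrow> bool" where
  "M_regular R M x \<longleftrightarrow> x \<in> carrier R \<and>
     (\<forall>y\<in>carrier M. x \<odot>\<^bsub>M\<^esub> y = \<zero>\<^bsub>M\<^esub> \<longrightarrow> y = \<zero>\<^bsub>M\<^esub>) \<and>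
     {x \<odot>\<^bsub>M\<^esub> y | y. y \<in> carrier M} \<noteq> carrier M"

text \<open>depth_R(M) \<ge> 1: there is an M-regular sequence of length 1 in m
  (with the convention depth(0) = \<infinity>).\<close>
definition depth_ge_1 :: "'a ring \<Rightarrow> 'a set \<Rightarrow> ('a, 'm) module \<Rightarrow> bool" where
  "depth_ge_1 R m M \<longleftrightarrow> carrier M = {\<zero>\<^bsub>M\<^esub>} \<or> (\<exists>x\<in>m. M_regular R M x)"

end

theory Submission
  imports Defs
begin

text \<open>
  Everything takes place in complexes of the form $M^p \to M^q \to M^r$ with maps $A$, $B$ given by
  matrices over $R$. Multiplication by a regular $x \in m$ maps $M$ injectively into $mM$, and this
  yields: if such a complex is exact on $mM$ then it is exact on $M$. Indeed, splitting off unit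
  entries of $A$ one may assume that $A$ has entries in $m$. Then $A(M^p)$ consists of cycles with
  entries in $mM$, so $A(M^p) \subseteq A((mM)^p) = m A(M^p)$ and $A(M^p) = 0$ by Nakayama. If $u$ is
  a cycle then so is $xu$, whose entries lie in $mM$; hence $xu \in A(M^p) = 0$ and $u = 0$.
  Iterating gives $m^t M$ in place of $mM$. For Ext this applies to $\mathrm{Hom}(F, M)$ with $F$
  the given resolution of $N$. For Tor, which is computed from resolutions of the first argument, it
  applies after replacing $F \otimes N$ by $M \otimes P$ with $P$ a resolution of $N$; the vanishing
  of the homology of the two is equivalent by a chase in the double complex $F \otimes P$.
\<close>

section \<open>Linear combinations and matrix actions\<close>

text \<open>Ext is tested on every free resolution of \<open>N\<close>, so passing to a minimal
  resolution, whose differentials would have entries in \<open>m\<close> from the start, would call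
  for a comparison of resolutions; pivoting on unit entries inside the exactness statement takes its
  place. The argument keeps the matrices fixed and varies only the coefficient module. A resolution
  of \<open>N\<close> serves \<open>M\<close> and m^t M alike, whereas resolutions of
  \<open>M\<close> and of m^t M are unrelated. Hence Tor is balanced twice: from a resolution of m^t
  M to one of \<open>N\<close>, and back to an arbitrary resolution of \<open>M\<close>. The first
  passage needs actual resolutions of m^t M and of \<open>N\<close>, which is what the finite
  generation of syzygies is for. m^t M is realised by shrinking the carrier of \<open>M\<close>.
  Finite sums in a module refer to its carrier, so linear combinations have to be transferred
  between \<open>M\<close> and its submodules explicitly.\<close>

lemma ring_module_simps [simp]:
  "carrier (ring_module R) = carrier R" "\<zero>\<^bsub>ring_module R\<^esub> = \<zero>\<^bsub>R\<^esub>"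
  "add (ring_module R) = add R" "module.smult (ring_module R) = monoid.mult R"
  by (simp_all add: ring_module_def)

lemma module_ring_module:
  assumes "cring R" shows "module R (ring_module R)"
proof -
  interpret cring R by fact
  show ?thesis
  proof (rule moduleI)
    show "abelian_group (ring_module R)"
      by (rule abelian_groupI) (auto simp: a_assoc intro: a_comm l_neg a_inv_closed)
  qed (auto simp: l_distr r_distr m_assoc assms)
qed

lemma a_inv_ring_module [simp]: "a_inv (ring_module R) = a_inv R"
  by (rule ext) (simp add: a_inv_def m_inv_def)

lemma a_minus_ring_module [simp]: "a_minus (ring_module R) = a_minus R"
  by (intro ext) (simp add: a_minus_def)

locale basic_module = module R M for R :: "'a ring" and M :: "('a, 'm) module"

text \<open>The ring is a module over itself, so each lemma on \<open>M\<close> also holds for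
  coordinate vectors over \<open>R\<close>, under the prefix \<open>S\<close>; resolutions mix the
  two.\<close>

sublocale basic_module \<subseteq> S: basic_module R "ring_module R"
  using module_ring_module[OF R.is_cring] by (simp add: basic_module_def)

context basic_module
begin

lemma lincomb_0 [simp]: "lincomb M c x 0 = \<zero>\<^bsub>M\<^esub>"
  by (simp add: lincomb_def)

end

context basic_module
begin

lemma lincomb_Suc:
  assumes "\<And>j. j \<le> b \<Longrightarrow> c j \<in> carrier R" "\<And>j. j \<le> b \<Longrightarrow> x j \<in> carrier M"
  shows "lincomb M c x (Suc b) = lincomb M c x b \<oplus>\<^bsub>M\<^esub> c b \<odot>\<^bsub>M\<^esub> x b"
proof -
  have "finsum M (\<lambda>j. c j \<odot>\<^bsub>M\<^esub> x j) (insert b {..<b})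
     = c b \<odot>\<^bsub>M\<^esub> x b \<oplus>\<^bsub>M\<^esub> finsum M (\<lambda>j. c j \<odot>\<^bsub>M\<^esub> x j) {..<b}"
    by (rule M.finsum_insert) (auto simp: assms)
  also have "\<dots> = finsum M (\<lambda>j. c j \<odot>\<^bsub>M\<^esub> x j) {..<b} \<oplus>\<^bsub>M\<^esub> c b \<odot>\<^bsub>M\<^esub> x b"
    by (rule M.a_comm) (auto simp: assms intro!: M.finsum_closed)
  finally show ?thesis by (simp add: lincomb_def lessThan_Suc)
qed

lemma lincomb_closed [intro, simp]:
  assumes "\<And>j. j < b \<Longrightarrow> c j \<in> carrier R" "\<And>j. j < b \<Longrightarrow> x j \<in> carrier M"
  shows "lincomb M c x b \<in> carrier M"
  unfolding lincomb_def by (rule M.finsum_closed) (auto simp: assms)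

lemma lincomb_cong:
  assumes "\<And>j. j < b \<Longrightarrow> c j \<in> carrier R" "\<And>j. j < b \<Longrightarrow> x j \<in> carrier M"
    and "\<And>j. j < b \<Longrightarrow> c' j = c j" "\<And>j. j < b \<Longrightarrow> x' j = x j"
  shows "lincomb M c' x' b = lincomb M c x b"
  unfolding lincomb_def by (rule M.finsum_cong') (auto simp: assms)

lemma lincomb_zero_l:
  assumes "\<And>j. j < b \<Longrightarrow> c j = \<zero>\<^bsub>R\<^esub>" "\<And>j. j < b \<Longrightarrow> x j \<in> carrier M"
  shows "lincomb M c x b = \<zero>\<^bsub>M\<^esub>"
  unfolding lincomb_def by (rule M.add.finprod_one_eqI) (simp add: assms)

lemma lincomb_zero_r:
  assumes "\<And>j. j < b \<Longrightarrow> c j \<in> carrier R" "\<And>j. j < b \<Longrightarrow> x j = \<zero>\<^bsub>M\<^esub>"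
  shows "lincomb M c x b = \<zero>\<^bsub>M\<^esub>"
  unfolding lincomb_def by (rule M.add.finprod_one_eqI) (simp add: assms)

lemma lincomb_add_r:
  assumes "\<And>j. j < b \<Longrightarrow> c j \<in> carrier R" "\<And>j. j < b \<Longrightarrow> x j \<in> carrier M"
    "\<And>j. j < b \<Longrightarrow> y j \<in> carrier M"
  shows "lincomb M c (\<lambda>j. x j \<oplus>\<^bsub>M\<^esub> y j) b = lincomb M c x b \<oplus>\<^bsub>M\<^esub> lincomb M c y b"
proof -
  have "lincomb M c (\<lambda>j. x j \<oplus>\<^bsub>M\<^esub> y j) b
    = finsum M (\<lambda>j. c j \<odot>\<^bsub>M\<^esub> x j \<oplus>\<^bsub>M\<^esub> c j \<odot>\<^bsub>M\<^esub> y j) {..<b}"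
    unfolding lincomb_def by (rule M.finsum_cong') (auto simp: assms smult_r_distr)
  also have "\<dots> = lincomb M c x b \<oplus>\<^bsub>M\<^esub> lincomb M c y b"
    unfolding lincomb_def by (rule M.finsum_addf) (auto simp: assms)
  finally show ?thesis .
qed

lemma lincomb_add_l:
  assumes "\<And>j. j < b \<Longrightarrow> c j \<in> carrier R" "\<And>j. j < b \<Longrightarrow> d j \<in> carrier R"
    "\<And>j. j < b \<Longrightarrow> x j \<in> carrier M"
  shows "lincomb M (\<lambda>j. c j \<oplus>\<^bsub>R\<^esub> d j) x b = lincomb M c x b \<oplus>\<^bsub>M\<^esub> lincomb M d x b"
proof -
  have "lincomb M (\<lambda>j. c j \<oplus>\<^bsub>R\<^esub> d j) x b
    = finsum M (\<lambda>j. c j \<odot>\<^bsub>M\<^esub> x j \<oplus>\<^bsub>M\<^esub> d j \<odot>\<^bsub>M\<^esub> x j) {..<b}"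
    unfolding lincomb_def by (rule M.finsum_cong') (auto simp: assms smult_l_distr)
  also have "\<dots> = lincomb M c x b \<oplus>\<^bsub>M\<^esub> lincomb M d x b"
    unfolding lincomb_def by (rule M.finsum_addf) (auto simp: assms)
  finally show ?thesis .
qed

lemma lincomb_smult_r:
  assumes "a \<in> carrier R" "\<And>j. j < b \<Longrightarrow> c j \<in> carrier R" "\<And>j. j < b \<Longrightarrow> x j \<in> carrier M"
  shows "lincomb M c (\<lambda>j. a \<odot>\<^bsub>M\<^esub> x j) b = a \<odot>\<^bsub>M\<^esub> lincomb M c x b"
proof -
  have "lincomb M c (\<lambda>j. a \<odot>\<^bsub>M\<^esub> x j) b = finsum M (\<lambda>j. a \<odot>\<^bsub>M\<^esub> (c j \<odot>\<^bsub>M\<^esub> x j)) {..<b}"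
    unfolding lincomb_def
    by (rule M.finsum_cong') (auto simp: assms smult_assoc1[symmetric] R.m_comm)
  also have "\<dots> = a \<odot>\<^bsub>M\<^esub> lincomb M c x b"
    unfolding lincomb_def by (rule finsum_smult_ldistr[symmetric]) (auto simp: assms)
  finally show ?thesis .
qed

lemma lincomb_smult_l:
  assumes "a \<in> carrier R" "\<And>j. j < b \<Longrightarrow> c j \<in> carrier R" "\<And>j. j < b \<Longrightarrow> x j \<in> carrier M"
  shows "lincomb M (\<lambda>j. a \<otimes>\<^bsub>R\<^esub> c j) x b = a \<odot>\<^bsub>M\<^esub> lincomb M c x b"
proof -
  have "lincomb M (\<lambda>j. a \<otimes>\<^bsub>R\<^esub> c j) x b = finsum M (\<lambda>j. a \<odot>\<^bsub>M\<^esub> (c j \<odot>\<^bsub>M\<^esub> x j)) {..<b}"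
    unfolding lincomb_def
    by (rule M.finsum_cong') (auto simp: assms smult_assoc1)
  also have "\<dots> = a \<odot>\<^bsub>M\<^esub> lincomb M c x b"
    unfolding lincomb_def by (rule finsum_smult_ldistr[symmetric]) (auto simp: assms)
  finally show ?thesis .
qed

lemma minus_eq_smult:
  assumes "x \<in> carrier M" "y \<in> carrier M"
  shows "x \<ominus>\<^bsub>M\<^esub> y = x \<oplus>\<^bsub>M\<^esub> (\<ominus>\<^bsub>R\<^esub> \<one>\<^bsub>R\<^esub>) \<odot>\<^bsub>M\<^esub> y"
  using assms by (simp add: a_minus_def smult_l_minus)

lemma lincomb_minus_r:
  assumes "\<And>j. j < b \<Longrightarrow> c j \<in> carrier R" "\<And>j. j < b \<Longrightarrow> x j \<in> carrier M"
    "\<And>j. j < b \<Longrightarrow> y j \<in> carrier M"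
  shows "lincomb M c (\<lambda>j. x j \<ominus>\<^bsub>M\<^esub> y j) b = lincomb M c x b \<ominus>\<^bsub>M\<^esub> lincomb M c y b"
proof -
  have "lincomb M c (\<lambda>j. x j \<ominus>\<^bsub>M\<^esub> y j) b
      = lincomb M c (\<lambda>j. x j \<oplus>\<^bsub>M\<^esub> (\<ominus>\<^bsub>R\<^esub> \<one>\<^bsub>R\<^esub>) \<odot>\<^bsub>M\<^esub> y j) b"
    by (rule lincomb_cong) (auto simp: assms minus_eq_smult)
  then show ?thesis
    by (simp add: assms lincomb_add_r lincomb_smult_r minus_eq_smult)
qed

lemma lincomb_minus_l:
  assumes "\<And>j. j < b \<Longrightarrow> c j \<in> carrier R" "\<And>j. j < b \<Longrightarrow> d j \<in> carrier R"
    "\<And>j. j < b \<Longrightarrow> x j \<in> carrier M"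
  shows "lincomb M (\<lambda>j. c j \<ominus>\<^bsub>R\<^esub> d j) x b = lincomb M c x b \<ominus>\<^bsub>M\<^esub> lincomb M d x b"
proof -
  have "lincomb M (\<lambda>j. c j \<ominus>\<^bsub>R\<^esub> d j) x b
      = lincomb M (\<lambda>j. c j \<oplus>\<^bsub>R\<^esub> (\<ominus>\<^bsub>R\<^esub> \<one>\<^bsub>R\<^esub>) \<otimes>\<^bsub>R\<^esub> d j) x b"
    by (rule lincomb_cong) (auto simp: assms R.l_minus a_minus_def)
  then show ?thesis
    by (simp add: assms lincomb_add_l lincomb_smult_l minus_eq_smult)
qed

text \<open>Exchange of the order of summation; this is what makes the two differentials of the
  double complex commute.\<close>

lemma lincomb_swap:
  assumes "\<And>j. j < p \<Longrightarrow> a j \<in> carrier R" "\<And>i. i < b \<Longrightarrow> c i \<in> carrier R"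
    "\<And>i j. i < b \<Longrightarrow> j < p \<Longrightarrow> x i j \<in> carrier M"
  shows "lincomb M a (\<lambda>j. lincomb M c (\<lambda>i. x i j) b) p = lincomb M c (\<lambda>i. lincomb M a (x i) p) b"
  using assms
proof (induction p)
  case 0
  then show ?case by (simp add: lincomb_zero_r)
next
  case (Suc p)
  have "lincomb M c (\<lambda>i. lincomb M a (x i) (Suc p)) b
      = lincomb M c (\<lambda>i. lincomb M a (x i) p \<oplus>\<^bsub>M\<^esub> a p \<odot>\<^bsub>M\<^esub> x i p) b"
    by (rule lincomb_cong) (auto simp: Suc.prems lincomb_Suc)
  also have "\<dots> = lincomb M c (\<lambda>i. lincomb M a (x i) p) b \<oplus>\<^bsub>M\<^esub> a p \<odot>\<^bsub>M\<^esub> lincomb M c (\<lambda>i. x i p) b"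
    by (simp add: Suc.prems lincomb_add_r lincomb_smult_r)
  also have "\<dots> = lincomb M a (\<lambda>j. lincomb M c (\<lambda>i. x i j) b) (Suc p)"
    by (subst lincomb_Suc) (auto simp: Suc)
  finally show ?case by simp
qed

end

context basic_module
begin

text \<open>Associativity a(ze) = (az)e for a row \<open>a\<close>, a matrix \<open>z\<close> over
  the ring and a column \<open>e\<close> in the module. It turns identities between matrices into
  identities between their actions.\<close>

lemma lincomb_lincomb:
  assumes "\<And>j. j < p \<Longrightarrow> a j \<in> carrier R" "\<And>i. i < b \<Longrightarrow> e i \<in> carrier M"
    "\<And>i j. i < b \<Longrightarrow> j < p \<Longrightarrow> z i j \<in> carrier R"
  shows "lincomb M a (\<lambda>j. lincomb M (\<lambda>i. z i j) e b) p
       = lincomb M (\<lambda>i. lincomb (ring_module R) a (z i) p) e b"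
  using assms
proof (induction p)
  case 0
  then show ?case by (simp add: lincomb_zero_l S.lincomb_0)
next
  case (Suc p)
  have cl: "lincomb (ring_module R) a (z i) p \<in> carrier R" if "i < b" for i
    using S.lincomb_closed[of p a "z i"] Suc.prems that by simp
  have "lincomb M (\<lambda>i. lincomb (ring_module R) a (z i) (Suc p)) e b
      = lincomb M (\<lambda>i. lincomb (ring_module R) a (z i) p \<oplus>\<^bsub>R\<^esub> a p \<otimes>\<^bsub>R\<^esub> z i p) e b"
    by (rule lincomb_cong) (auto simp: Suc.prems S.lincomb_Suc cl)
  also have "\<dots> = lincomb M (\<lambda>i. lincomb (ring_module R) a (z i) p) e b
      \<oplus>\<^bsub>M\<^esub> a p \<odot>\<^bsub>M\<^esub> lincomb M (\<lambda>i. z i p) e b"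
    by (simp add: Suc.prems lincomb_add_l lincomb_smult_l cl)
  also have "\<dots> = lincomb M a (\<lambda>j. lincomb M (\<lambda>i. z i j) e b) (Suc p)"
    by (subst lincomb_Suc) (auto simp: Suc)
  finally show ?case by simp
qed

lemma lincomb_delta_l:
  assumes "j < b" "a \<in> carrier R" "\<And>i. i < b \<Longrightarrow> x i \<in> carrier M"
  shows "lincomb M (\<lambda>i. if i = j then a else \<zero>\<^bsub>R\<^esub>) x b = a \<odot>\<^bsub>M\<^esub> x j"
proof -
  have "lincomb M (\<lambda>i. if i = j then a else \<zero>\<^bsub>R\<^esub>) x b
      = finsum M (\<lambda>i. if j = i then a \<odot>\<^bsub>M\<^esub> x i else \<zero>\<^bsub>M\<^esub>) {..<b}"
    unfolding lincomb_def by (rule M.finsum_cong') (auto simp: assms)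
  also have "\<dots> = a \<odot>\<^bsub>M\<^esub> x j"
    by (rule M.finsum_singleton) (auto simp: assms)
  finally show ?thesis .
qed

lemma lincomb_delta_r:
  assumes "j < b" "y \<in> carrier M" "\<And>i. i < b \<Longrightarrow> c i \<in> carrier R"
  shows "lincomb M c (\<lambda>i. if i = j then y else \<zero>\<^bsub>M\<^esub>) b = c j \<odot>\<^bsub>M\<^esub> y"
proof -
  have "lincomb M c (\<lambda>i. if i = j then y else \<zero>\<^bsub>M\<^esub>) b
      = finsum M (\<lambda>i. if j = i then c i \<odot>\<^bsub>M\<^esub> y else \<zero>\<^bsub>M\<^esub>) {..<b}"
    unfolding lincomb_def by (rule M.finsum_cong') (auto simp: assms)
  also have "\<dots> = c j \<odot>\<^bsub>M\<^esub> y"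
    by (rule M.finsum_singleton) (auto simp: assms)
  finally show ?thesis .
qed

end

section \<open>Vectors and linearity of the matrix action\<close>

lemma vecsI: "(\<And>j. j < b \<Longrightarrow> u j \<in> carrier M) \<Longrightarrow> (\<And>j. b \<le> j \<Longrightarrow> u j = \<zero>\<^bsub>M\<^esub>) \<Longrightarrow> u \<in> vecs M b"
  by (simp add: vecs_def)

lemma vecsD: "u \<in> vecs M b \<Longrightarrow> j < b \<Longrightarrow> u j \<in> carrier M"
  by (simp add: vecs_def)

lemma vecs_zero: "u \<in> vecs M b \<Longrightarrow> b \<le> j \<Longrightarrow> u j = \<zero>\<^bsub>M\<^esub>"
  by (simp add: vecs_def)

lemma vecs_ext:
  "u \<in> vecs M b \<Longrightarrow> v \<in> vecs M b \<Longrightarrow> (\<And>j. j < b \<Longrightarrow> u j = v j) \<Longrightarrow> u = v"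
  by (rule ext) (metis not_le vecs_zero)

lemma mat_act_lincomb: "mat_act M A p q u = (\<lambda>k. if k < q then lincomb M (A k) u p else \<zero>\<^bsub>M\<^esub>)"
  unfolding mat_act_def lincomb_def ..

context basic_module
begin

lemma vecs_carrier: "u \<in> vecs M b \<Longrightarrow> u j \<in> carrier M"
  by (cases "j < b") (auto simp: vecs_def)

end

context basic_module
begin

lemma vecs_S_carrier: "u \<in> vecs (ring_module R) b \<Longrightarrow> u j \<in> carrier R"
  using S.vecs_carrier by simp

lemma zero_vecs: "(\<lambda>_. \<zero>\<^bsub>M\<^esub>) \<in> vecs M b"
  by (simp add: vecs_def)

lemma delta_vecs: "j < b \<Longrightarrow> y \<in> carrier M \<Longrightarrow> (\<lambda>i. if i = j then y else \<zero>\<^bsub>M\<^esub>) \<in> vecs M b"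
  by (simp add: vecs_def)

lemma add_vecs: "u \<in> vecs M b \<Longrightarrow> v \<in> vecs M b \<Longrightarrow> (\<lambda>i. u i \<oplus>\<^bsub>M\<^esub> v i) \<in> vecs M b"
  by (simp add: vecs_def)

lemma minus_vecs: "u \<in> vecs M b \<Longrightarrow> v \<in> vecs M b \<Longrightarrow> (\<lambda>i. u i \<ominus>\<^bsub>M\<^esub> v i) \<in> vecs M b"
  by (simp add: vecs_def a_minus_def)

lemma smult_vecs: "a \<in> carrier R \<Longrightarrow> u \<in> vecs M b \<Longrightarrow> (\<lambda>i. a \<odot>\<^bsub>M\<^esub> u i) \<in> vecs M b"
  by (simp add: vecs_def)

end

definition mat_over :: "'a ring \<Rightarrow> (nat \<Rightarrow> nat \<Rightarrow> 'a) \<Rightarrow> nat \<Rightarrow> nat \<Rightarrow> bool" where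
  "mat_over R A p q \<longleftrightarrow> (\<forall>k<q. \<forall>j<p. A k j \<in> carrier R)"

lemma mat_overD: "mat_over R A p q \<Longrightarrow> k < q \<Longrightarrow> j < p \<Longrightarrow> A k j \<in> carrier R"
  by (simp add: mat_over_def)

context basic_module
begin

lemma mat_act_closed:
  assumes "mat_over R A p q" "u \<in> vecs M p"
  shows "mat_act M A p q u \<in> vecs M q"
  using assms by (intro vecsI) (auto simp: mat_act_lincomb dest: mat_overD vecsD)

lemma mat_act_zero:
  assumes "mat_over R A p q"
  shows "mat_act M A p q (\<lambda>_. \<zero>\<^bsub>M\<^esub>) = (\<lambda>_. \<zero>\<^bsub>M\<^esub>)"
  using assms by (intro ext) (auto simp: mat_act_lincomb intro!: lincomb_zero_r dest: mat_overD)

lemma mat_act_add: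
  assumes "mat_over R A p q" "u \<in> vecs M p" "v \<in> vecs M p"
  shows "mat_act M A p q (\<lambda>i. u i \<oplus>\<^bsub>M\<^esub> v i)
    = (\<lambda>k. mat_act M A p q u k \<oplus>\<^bsub>M\<^esub> mat_act M A p q v k)"
  using assms by (intro ext) (auto simp: mat_act_lincomb intro!: lincomb_add_r dest: mat_overD vecsD)

lemma minus_self: "x \<in> carrier M \<Longrightarrow> x \<ominus>\<^bsub>M\<^esub> x = \<zero>\<^bsub>M\<^esub>"
  by (simp add: a_minus_def M.r_neg)

lemma mat_act_minus:
  assumes "mat_over R A p q" "u \<in> vecs M p" "v \<in> vecs M p"
  shows "mat_act M A p q (\<lambda>i. u i \<ominus>\<^bsub>M\<^esub> v i)
    = (\<lambda>k. mat_act M A p q u k \<ominus>\<^bsub>M\<^esub> mat_act M A p q v k)"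
  using assms
  by (intro ext) (auto simp: mat_act_lincomb minus_self intro!: lincomb_minus_r dest: mat_overD vecsD)

lemma mat_act_smult:
  assumes "mat_over R A p q" "u \<in> vecs M p" "a \<in> carrier R"
  shows "mat_act M A p q (\<lambda>i. a \<odot>\<^bsub>M\<^esub> u i) = (\<lambda>k. a \<odot>\<^bsub>M\<^esub> mat_act M A p q u k)"
  using assms by (intro ext) (auto simp: mat_act_lincomb intro!: lincomb_smult_r dest: mat_overD vecsD)

end

section \<open>Local rings, Nakayama's lemma and products with ideals\<close>

text \<open>A nonunit generates a proper ideal, which lies in a maximal one, and by uniqueness this
  is \<open>m\<close>. The maximal ideal comes from Zorn's lemma, applied to the ideals that contain
  \<open>a\<close> but not 1.\<close>

lemma unit_outside_maximal:
  fixes R :: "'a ring"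
  assumes "noetherian_local R m" "a \<in> carrier R" "a \<notin> m"
  shows "a \<in> Units R"
proof (rule ccontr)
  assume nu: "a \<notin> Units R"
  interpret cring R using assms(1) by (simp add: noetherian_local_def)
  interpret N: noetherian_ring R using assms(1) by (simp add: noetherian_local_def)
  define C where "C = {I. ideal I R \<and> a \<in> I \<and> \<one>\<^bsub>R\<^esub> \<notin> I}"
  have "\<one>\<^bsub>R\<^esub> \<notin> PIdl\<^bsub>R\<^esub> a"
  proof
    assume "\<one>\<^bsub>R\<^esub> \<in> PIdl\<^bsub>R\<^esub> a"
    then obtain r where "r \<in> carrier R" "\<one>\<^bsub>R\<^esub> = r \<otimes>\<^bsub>R\<^esub> a" unfolding cgenideal_def by auto
    with nu assms(2) show False unfolding Units_def by (auto simp: m_comm)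
  qed
  then have CP: "PIdl\<^bsub>R\<^esub> a \<in> C"
    using assms(2) by (auto simp: C_def cgenideal_ideal intro: cgenideal_self)
  have "\<exists>J\<in>C. \<forall>V\<in>C. J \<subseteq> V \<longrightarrow> V = J"
  proof (rule subset_Zorn)
    fix D assume D: "subset.chain C D"
    show "\<exists>U\<in>C. \<forall>V\<in>D. V \<subseteq> U"
    proof (cases "D = {}")
      case True
      with CP show ?thesis by auto
    next
      case False
      \<comment> \<open>In a Noetherian ring a nonempty chain of ideals contains its own union,
        which is then the upper bound.\<close>
      have "subset.chain {I. ideal I R} D"
        using D unfolding subset.chain_def C_def by auto
      from N.ideal_chain_is_trivial[OF False this] have "\<Union>D \<in> D" .
      moreover from this have "\<Union>D \<in> C" using D unfolding subset.chain_def by auto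
      ultimately show ?thesis by blast
    qed
  qed
  then obtain J where J: "J \<in> C" and Jmax: "\<And>V. V \<in> C \<Longrightarrow> J \<subseteq> V \<Longrightarrow> V = J" by blast
  have "maximalideal J R"
  proof (rule maximalidealI)
    show "ideal J R" using J by (simp add: C_def)
    show "carrier R \<noteq> J" using J by (auto simp: C_def)
    fix V assume V: "ideal V R" "J \<subseteq> V" "V \<subseteq> carrier R"
    show "V = J \<or> V = carrier R"
    proof (cases "\<one>\<^bsub>R\<^esub> \<in> V")
      case True
      then show ?thesis using ideal.one_imp_carrier[OF V(1)] by simp
    next
      case False
      then have "V \<in> C" using V J by (auto simp: C_def)
      then show ?thesis using Jmax V by simp
    qed
  qed
  then have "J = m" using assms(1) by (simp add: noetherian_local_def)
  with J assms(3) show False by (simp add: C_def)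
qed

locale local_module = basic_module R M for R :: "'a ring" and M :: "('a, 'm) module" +
  fixes m :: "'a set"
  assumes local: "noetherian_local R m"

sublocale local_module \<subseteq> m: maximalideal m R
  using local by (simp add: noetherian_local_def)

sublocale local_module \<subseteq> noetherian_ring R
  using local by (simp add: noetherian_local_def)

context local_module
begin

lemma m_carrier: "a \<in> m \<Longrightarrow> a \<in> carrier R"
  using m.a_subset by auto

lemma one_minus_unit:
  assumes "a \<in> m" shows "\<one>\<^bsub>R\<^esub> \<ominus>\<^bsub>R\<^esub> a \<in> Units R"
proof (rule unit_outside_maximal[OF local])
  have a: "a \<in> carrier R" using assms by (rule m_carrier)
  then show "\<one>\<^bsub>R\<^esub> \<ominus>\<^bsub>R\<^esub> a \<in> carrier R" by simp
  show "\<one>\<^bsub>R\<^esub> \<ominus>\<^bsub>R\<^esub> a \<notin> m"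
  proof
    assume "\<one>\<^bsub>R\<^esub> \<ominus>\<^bsub>R\<^esub> a \<in> m"
    with assms have "(\<one>\<^bsub>R\<^esub> \<ominus>\<^bsub>R\<^esub> a) \<oplus>\<^bsub>R\<^esub> a \<in> m" by (intro m.a_closed)
    with a have "\<one>\<^bsub>R\<^esub> \<in> m" by (simp add: a_minus_def R.a_assoc R.l_neg)
    then show False using m.one_imp_carrier m.I_notcarr by auto
  qed
qed

text \<open>Gaussian elimination in place of a determinant: 1 - \<open>a g g\<close> is a unit, so
  the equation for \<open>v g\<close> can be solved and substituted into the others, whose new
  coefficients again lie in \<open>m\<close>. The form with a finite family fits the application,
  where the family is explicit.\<close>

lemma nakayama:
  assumes "finite I" "\<And>i. i \<in> I \<Longrightarrow> v i \<in> carrier M"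
    "\<And>i j. i \<in> I \<Longrightarrow> j \<in> I \<Longrightarrow> a i j \<in> m"
    "\<And>i. i \<in> I \<Longrightarrow> v i = (\<Oplus>\<^bsub>M\<^esub> j\<in>I. a i j \<odot>\<^bsub>M\<^esub> v j)"
    "i \<in> I"
  shows "v i = \<zero>\<^bsub>M\<^esub>"
  using assms
proof (induction I arbitrary: a i rule: finite_induct)
  case empty
  from empty.prems(4) show ?case by simp
next
  case (insert g I)
  have v: "v i \<in> carrier M" if "i \<in> I" for i using insert.prems(1) that by simp
  have vg: "v g \<in> carrier M" using insert.prems(1) by simp
  have a: "a i j \<in> carrier R" if "i \<in> insert g I" "j \<in> insert g I" for i j
    using insert.prems(2) that by (intro m_carrier)
  have split: "v i = a i g \<odot>\<^bsub>M\<^esub> v g \<oplus>\<^bsub>M\<^esub> (\<Oplus>\<^bsub>M\<^esub> j\<in>I. a i j \<odot>\<^bsub>M\<^esub> v j)" if "i \<in> insert g I" for i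
  proof -
    have "v i = (\<Oplus>\<^bsub>M\<^esub> j\<in>insert g I. a i j \<odot>\<^bsub>M\<^esub> v j)" by (rule insert.prems(3)[OF that])
    also have "\<dots> = a i g \<odot>\<^bsub>M\<^esub> v g \<oplus>\<^bsub>M\<^esub> (\<Oplus>\<^bsub>M\<^esub> j\<in>I. a i j \<odot>\<^bsub>M\<^esub> v j)"
      by (rule M.finsum_insert) (use insert.hyps v vg a that in auto)
    finally show ?thesis .
  qed
  have s: "(\<Oplus>\<^bsub>M\<^esub> j\<in>I. a i j \<odot>\<^bsub>M\<^esub> v j) \<in> carrier M" if "i \<in> insert g I" for i
    by (rule M.finsum_closed) (use v a that in auto)
  obtain u where u: "u \<in> carrier R" "u \<otimes>\<^bsub>R\<^esub> (\<one>\<^bsub>R\<^esub> \<ominus>\<^bsub>R\<^esub> a g g) = \<one>\<^bsub>R\<^esub>"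
    using one_minus_unit[of "a g g"] insert.prems(2) unfolding Units_def by auto
  have agg: "a g g \<in> carrier R" using a by simp
  have "(\<one>\<^bsub>R\<^esub> \<ominus>\<^bsub>R\<^esub> a g g) \<odot>\<^bsub>M\<^esub> v g = v g \<ominus>\<^bsub>M\<^esub> a g g \<odot>\<^bsub>M\<^esub> v g"
    using agg vg by (simp add: a_minus_def smult_l_distr smult_l_minus)
  also have "\<dots> = (\<Oplus>\<^bsub>M\<^esub> j\<in>I. a g j \<odot>\<^bsub>M\<^esub> v j)"
    using split[of g] s[of g] agg vg
    by (metis M.add.inv_solve_right' M.a_comm a_minus_def insertI1 smult_closed M.minus_closed)
  finally have "u \<odot>\<^bsub>M\<^esub> ((\<one>\<^bsub>R\<^esub> \<ominus>\<^bsub>R\<^esub> a g g) \<odot>\<^bsub>M\<^esub> v g) = u \<odot>\<^bsub>M\<^esub> (\<Oplus>\<^bsub>M\<^esub> j\<in>I. a g j \<odot>\<^bsub>M\<^esub> v j)"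
    by simp
  then have vg_eq: "v g = u \<odot>\<^bsub>M\<^esub> (\<Oplus>\<^bsub>M\<^esub> j\<in>I. a g j \<odot>\<^bsub>M\<^esub> v j)"
    using u agg vg by (simp add: smult_assoc1[symmetric])
  \<comment> \<open>The coefficients of the i-th equation after \<open>v g\<close> has been
    eliminated by \<open>vg_eq\<close>.\<close>
  define a' where "a' i j = (a i g \<otimes>\<^bsub>R\<^esub> u) \<otimes>\<^bsub>R\<^esub> a g j \<oplus>\<^bsub>R\<^esub> a i j" for i j
  have a'm: "a' i j \<in> m" if "i \<in> I" "j \<in> I" for i j
    unfolding a'_def using insert.prems(2) that u a
    by (intro m.a_closed m.I_l_closed) auto
  have IH: "v i = \<zero>\<^bsub>M\<^esub>" if "i \<in> I" for i
  proof (rule insert.IH[OF v a'm _ that])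
    fix i assume i: "i \<in> I"
    have "v i = a i g \<odot>\<^bsub>M\<^esub> (u \<odot>\<^bsub>M\<^esub> (\<Oplus>\<^bsub>M\<^esub> j\<in>I. a g j \<odot>\<^bsub>M\<^esub> v j)) \<oplus>\<^bsub>M\<^esub> (\<Oplus>\<^bsub>M\<^esub> j\<in>I. a i j \<odot>\<^bsub>M\<^esub> v j)"
      using split[OF insertI2[OF i]] unfolding vg_eq[symmetric] .
    also have "a i g \<odot>\<^bsub>M\<^esub> (u \<odot>\<^bsub>M\<^esub> (\<Oplus>\<^bsub>M\<^esub> j\<in>I. a g j \<odot>\<^bsub>M\<^esub> v j))
        = (a i g \<otimes>\<^bsub>R\<^esub> u) \<odot>\<^bsub>M\<^esub> (\<Oplus>\<^bsub>M\<^esub> j\<in>I. a g j \<odot>\<^bsub>M\<^esub> v j)"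
      using u a i s by (simp add: smult_assoc1)
    also have "\<dots> = (\<Oplus>\<^bsub>M\<^esub> j\<in>I. (a i g \<otimes>\<^bsub>R\<^esub> u) \<odot>\<^bsub>M\<^esub> (a g j \<odot>\<^bsub>M\<^esub> v j))"
      by (rule finsum_smult_ldistr) (use insert.hyps u a v i in auto)
    also have "\<dots> \<oplus>\<^bsub>M\<^esub> (\<Oplus>\<^bsub>M\<^esub> j\<in>I. a i j \<odot>\<^bsub>M\<^esub> v j)
        = (\<Oplus>\<^bsub>M\<^esub> j\<in>I. (a i g \<otimes>\<^bsub>R\<^esub> u) \<odot>\<^bsub>M\<^esub> (a g j \<odot>\<^bsub>M\<^esub> v j) \<oplus>\<^bsub>M\<^esub> a i j \<odot>\<^bsub>M\<^esub> v j)"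
      by (rule M.finsum_addf[symmetric]) (use u a v i in auto)
    also have "\<dots> = (\<Oplus>\<^bsub>M\<^esub> j\<in>I. a' i j \<odot>\<^bsub>M\<^esub> v j)"
      by (rule M.finsum_cong')
        (use u a v i m_carrier[OF a'm] in \<open>auto simp: a'_def smult_l_distr smult_assoc1\<close>)
    finally show "v i = (\<Oplus>\<^bsub>M\<^esub> j\<in>I. a' i j \<odot>\<^bsub>M\<^esub> v j)" .
  qed
  have "(\<Oplus>\<^bsub>M\<^esub> j\<in>I. a g j \<odot>\<^bsub>M\<^esub> v j) = \<zero>\<^bsub>M\<^esub>"
    by (rule M.add.finprod_one_eqI) (use IH a in auto)
  with vg_eq u have "v g = \<zero>\<^bsub>M\<^esub>" by simp
  with IH insert.prems(4) show ?case by auto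
qed

end

section \<open>Products of an ideal with a set of module elements\<close>

context basic_module
begin

lemma lincomb_in:
  assumes "\<zero>\<^bsub>M\<^esub> \<in> T" "\<And>u v. u \<in> T \<Longrightarrow> v \<in> T \<Longrightarrow> u \<oplus>\<^bsub>M\<^esub> v \<in> T"
    and "\<And>j. j < b \<Longrightarrow> c j \<in> carrier R" "\<And>j. j < b \<Longrightarrow> x j \<in> carrier M"
    and "\<And>j. j < b \<Longrightarrow> c j \<odot>\<^bsub>M\<^esub> x j \<in> T"
  shows "lincomb M c x b \<in> T"
  using assms(3-) by (induction b) (auto simp: assms(1,2) lincomb_Suc)

text \<open>The induction principle for the product: it suffices to check single products in a set
  closed under addition.\<close>

lemma ideal_times_in:
  assumes "z \<in> ideal_times M I V" "I \<subseteq> carrier R" "V \<subseteq> carrier M"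
    and "\<zero>\<^bsub>M\<^esub> \<in> T" "\<And>u v. u \<in> T \<Longrightarrow> v \<in> T \<Longrightarrow> u \<oplus>\<^bsub>M\<^esub> v \<in> T"
    and "\<And>a x. a \<in> I \<Longrightarrow> x \<in> V \<Longrightarrow> a \<odot>\<^bsub>M\<^esub> x \<in> T"
  shows "z \<in> T"
proof -
  from assms(1) obtain k a x where z: "z = lincomb M a x k" and ax: "\<And>i. i < k \<Longrightarrow> a i \<in> I \<and> x i \<in> V"
    unfolding ideal_times_def by blast
  show ?thesis unfolding z
    by (rule lincomb_in) (use assms ax in auto)
qed

lemma smult_ideal_times:
  assumes "I \<subseteq> carrier R" "V \<subseteq> carrier M" "a \<in> I" "x \<in> V"
  shows "a \<odot>\<^bsub>M\<^esub> x \<in> ideal_times M I V"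
proof -
  have "a \<odot>\<^bsub>M\<^esub> x = lincomb M (\<lambda>_. a) (\<lambda>_. x) (Suc 0)"
    using assms by (subst lincomb_Suc) (auto simp: subset_iff)
  with assms show ?thesis unfolding ideal_times_def by blast
qed

lemma zero_ideal_times: "\<zero>\<^bsub>M\<^esub> \<in> ideal_times M I V"
  unfolding ideal_times_def by (rule CollectI, rule exI[of _ 0]) simp

lemma ideal_times_carrier:
  assumes "z \<in> ideal_times M I V" "I \<subseteq> carrier R" "V \<subseteq> carrier M"
  shows "z \<in> carrier M"
  by (rule ideal_times_in[OF assms]) (use assms in auto)

text \<open>Concatenation of two families of products is reduced to appending a single product at
  position \<open>k\<close>: the set \<open>T\<close> of all \<open>w\<close> that may be added to
  any element is closed under addition, so \<open>ideal_times_in\<close> applies to it.\<close>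

lemma add_ideal_times:
  assumes "z \<in> ideal_times M I V" "w \<in> ideal_times M I V" "I \<subseteq> carrier R" "V \<subseteq> carrier M"
  shows "z \<oplus>\<^bsub>M\<^esub> w \<in> ideal_times M I V"
proof -
  define T where "T = {w \<in> carrier M. \<forall>z\<in>ideal_times M I V. z \<oplus>\<^bsub>M\<^esub> w \<in> ideal_times M I V}"
  have c: "z \<in> carrier M" if "z \<in> ideal_times M I V" for z
    using ideal_times_carrier that assms(3,4) by blast
  have "w \<in> T"
  proof (rule ideal_times_in[OF assms(2-4)])
    show "\<zero>\<^bsub>M\<^esub> \<in> T" by (auto simp: T_def c)
    fix u v assume "u \<in> T" "v \<in> T"
    then show "u \<oplus>\<^bsub>M\<^esub> v \<in> T" by (auto simp: T_def c M.a_assoc[symmetric])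
  next
    fix a x assume ax: "a \<in> I" "x \<in> V"
    have "z \<oplus>\<^bsub>M\<^esub> a \<odot>\<^bsub>M\<^esub> x \<in> ideal_times M I V" if "z \<in> ideal_times M I V" for z
    proof -
      from that obtain k b y where z: "z = lincomb M b y k" and bY: "\<And>i. i < k \<Longrightarrow> b i \<in> I \<and> y i \<in> V"
        unfolding ideal_times_def by blast
      have "lincomb M (b(k := a)) (y(k := x)) (Suc k)
          = lincomb M (b(k := a)) (y(k := x)) k \<oplus>\<^bsub>M\<^esub> a \<odot>\<^bsub>M\<^esub> x"
        using lincomb_Suc[of k "b(k := a)" "y(k := x)"] bY ax assms(3,4) by (auto simp: subset_iff)
      also have "lincomb M (b(k := a)) (y(k := x)) k = z"
        unfolding z by (rule lincomb_cong) (use bY assms(3,4) in auto)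
      finally have "z \<oplus>\<^bsub>M\<^esub> a \<odot>\<^bsub>M\<^esub> x = lincomb M (b(k := a)) (y(k := x)) (Suc k)" by (rule sym)
      moreover have "\<forall>i<Suc k. (b(k := a)) i \<in> I \<and> (y(k := x)) i \<in> V"
        using bY ax by (auto simp: less_Suc_eq)
      ultimately show ?thesis unfolding ideal_times_def by blast
    qed
    then show "a \<odot>\<^bsub>M\<^esub> x \<in> T" using ax assms(3,4) by (auto simp: T_def)
  qed
  then show ?thesis using assms(1) by (simp add: T_def)
qed

text \<open>A scalar is absorbed by the factor from the ideal, and negation is multiplication by
  -1.\<close>

lemma submodule_ideal_times:
  assumes "ideal I R" "V \<subseteq> carrier M"
  shows "submodule (ideal_times M I V) R M"
proof -
  interpret I: ideal I R by fact
  have I: "I \<subseteq> carrier R" by (rule I.a_subset)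
  have sm: "r \<odot>\<^bsub>M\<^esub> z \<in> ideal_times M I V" if "r \<in> carrier R" "z \<in> ideal_times M I V" for r z
  proof -
    have "z \<in> {z \<in> carrier M. r \<odot>\<^bsub>M\<^esub> z \<in> ideal_times M I V}"
    proof (rule ideal_times_in[OF that(2) I assms(2)])
      fix a x assume ax: "a \<in> I" "x \<in> V"
      then have c: "a \<in> carrier R" "x \<in> carrier M" using I assms(2) by auto
      then have "r \<odot>\<^bsub>M\<^esub> (a \<odot>\<^bsub>M\<^esub> x) = (r \<otimes>\<^bsub>R\<^esub> a) \<odot>\<^bsub>M\<^esub> x" using that(1) by (simp add: smult_assoc1)
      also have "\<dots> \<in> ideal_times M I V"
        by (rule smult_ideal_times[OF I assms(2)]) (use ax that(1) I.I_l_closed in auto)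
      finally show "a \<odot>\<^bsub>M\<^esub> x \<in> {z \<in> carrier M. r \<odot>\<^bsub>M\<^esub> z \<in> ideal_times M I V}" using c by simp
    qed (use that(1) in \<open>auto simp: zero_ideal_times smult_r_distr intro: add_ideal_times[OF _ _ I assms(2)]\<close>)
    then show ?thesis by simp
  qed
  show ?thesis
  proof (rule submoduleI)
    fix a assume a: "a \<in> ideal_times M I V"
    then have "a \<in> carrier M" using ideal_times_carrier I assms(2) by blast
    then have "\<ominus>\<^bsub>M\<^esub> a = (\<ominus>\<^bsub>R\<^esub> \<one>\<^bsub>R\<^esub>) \<odot>\<^bsub>M\<^esub> a" by (simp add: smult_l_minus)
    also have "\<dots> \<in> ideal_times M I V" by (rule sm) (use a in auto)
    finally show "\<ominus>\<^bsub>M\<^esub> a \<in> ideal_times M I V" .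
  qed (use ideal_times_carrier[OF _ I assms(2)] zero_ideal_times add_ideal_times[OF _ _ I assms(2)] sm in auto)
qed

end

section \<open>Descent of exactness from $mM$ to $M$\<close>

text \<open>Injectivity of multiplication by \<open>x\<close> passes to submodules, so with the same
  \<open>x\<close> the locale can be instantiated at every m^t M. The zero module is covered by
  \<open>x\<close> = 0.\<close>

locale regular_module = local_module +
  fixes x
  assumes fg: "fin_gen R M" and xm: "x \<in> m"
    and regular: "\<And>y. y \<in> carrier M \<Longrightarrow> x \<odot>\<^bsub>M\<^esub> y = \<zero>\<^bsub>M\<^esub> \<Longrightarrow> y = \<zero>\<^bsub>M\<^esub>"
begin

abbreviation "mM \<equiv> ideal_times M m (carrier M)"

text \<open>In a product of some \<open>a\<close> in \<open>m\<close> with an element of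
  \<open>M\<close>, the coefficients of that element on the fixed generators are multiplied by
  \<open>a\<close> and so move into \<open>m\<close>.\<close>

lemma mM_generators:
  assumes "\<forall>l<g. e l \<in> carrier M"
    and gen: "\<forall>z\<in>carrier M. \<exists>c\<in>vecs (ring_module R) g. z = lincomb M c e g"
    and "z \<in> mM"
  shows "\<exists>a. (\<forall>l<g. a l \<in> m) \<and> z = lincomb M a e g"
proof -
  have "z \<in> {lincomb M a e g | a. \<forall>l<g. a l \<in> m}"
  proof (rule ideal_times_in[OF assms(3) m.a_subset subset_refl])
    have "lincomb M (\<lambda>_. \<zero>\<^bsub>R\<^esub>) e g = \<zero>\<^bsub>M\<^esub>" by (rule lincomb_zero_l) (use assms in auto)
    moreover have "\<zero>\<^bsub>R\<^esub> \<in> m" by (rule m.zero_closed)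
    ultimately show "\<zero>\<^bsub>M\<^esub> \<in> {lincomb M a e g | a. \<forall>l<g. a l \<in> m}" by (auto intro!: exI[of _ "\<lambda>_. \<zero>\<^bsub>R\<^esub>"])
  next
    fix u v assume "u \<in> {lincomb M a e g | a. \<forall>l<g. a l \<in> m}" "v \<in> {lincomb M a e g | a. \<forall>l<g. a l \<in> m}"
    then obtain a b where ab: "u = lincomb M a e g" "v = lincomb M b e g"
      and m: "\<And>l. l < g \<Longrightarrow> a l \<in> m" "\<And>l. l < g \<Longrightarrow> b l \<in> m" by blast
    have "u \<oplus>\<^bsub>M\<^esub> v = lincomb M (\<lambda>l. a l \<oplus>\<^bsub>R\<^esub> b l) e g"
      unfolding ab by (rule lincomb_add_l[symmetric]) (use m m_carrier assms in auto)
    moreover have "\<forall>l<g. a l \<oplus>\<^bsub>R\<^esub> b l \<in> m" using m by (auto intro: m.a_closed)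
    ultimately show "u \<oplus>\<^bsub>M\<^esub> v \<in> {lincomb M a e g | a. \<forall>l<g. a l \<in> m}"
      by (auto intro!: exI[of _ "\<lambda>l. a l \<oplus>\<^bsub>R\<^esub> b l"])
  next
    fix a y assume ay: "a \<in> m" "y \<in> carrier M"
    then obtain c where c: "c \<in> vecs (ring_module R) g" "y = lincomb M c e g" using gen by blast
    have "a \<odot>\<^bsub>M\<^esub> y = lincomb M (\<lambda>l. a \<otimes>\<^bsub>R\<^esub> c l) e g"
      unfolding c(2) by (rule lincomb_smult_l[symmetric]) (use ay m_carrier assms c vecs_S_carrier in auto)
    moreover have "\<forall>l<g. a \<otimes>\<^bsub>R\<^esub> c l \<in> m" using ay c vecs_S_carrier by (auto intro: m.I_r_closed)
    ultimately show "a \<odot>\<^bsub>M\<^esub> y \<in> {lincomb M a e g | a. \<forall>l<g. a l \<in> m}"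
      by (auto intro!: exI[of _ "\<lambda>l. a \<otimes>\<^bsub>R\<^esub> c l"])
  qed
  then show ?thesis by blast
qed

text \<open>Nakayama is applied inside \<open>M\<close>, one row \<open>c\<close> at a time. With
  generators \<open>e l\<close> of \<open>M\<close>, the hypothesis \<open>img\<close>, A(M^p)
  contained in A((mM)^p), makes each of the finitely many elements \<open>A c k\<close> *
  \<open>e l\<close> a combination of all of them with coefficients in \<open>m\<close>. So they
  vanish, and every entry of \<open>A\<close> annihilates \<open>M\<close>.\<close>

lemma mat_act_eq_zero:
  assumes A: "\<And>k j. k < q \<Longrightarrow> j < p \<Longrightarrow> A k j \<in> m"
    and img: "\<And>w. w \<in> vecs M p \<Longrightarrow>
      \<exists>w'\<in>vecs M p. (\<forall>j<p. w' j \<in> mM) \<and> mat_act M A p q w = mat_act M A p q w'"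
    and w: "w \<in> vecs M p"
  shows "mat_act M A p q w = (\<lambda>_. \<zero>\<^bsub>M\<^esub>)"
proof -
  obtain g e where e: "\<forall>l<g. e l \<in> carrier M"
    and gen: "\<forall>z\<in>carrier M. \<exists>c\<in>vecs (ring_module R) g. z = lincomb M c e g"
    using fg unfolding fin_gen_def by blast
  have Ac: "A k j \<in> carrier R" if "k < q" "j < p" for k j using A that m_carrier by blast
  have kill_gen: "A c k \<odot>\<^bsub>M\<^esub> e l = \<zero>\<^bsub>M\<^esub>" if c: "c < q" and "k < p" "l < g" for c k l
  proof -
    define I where "I = {..<p} \<times> {..<g}"
    define v where "v = (\<lambda>(k, l). A c k \<odot>\<^bsub>M\<^esub> e l)"
    have v: "v i \<in> carrier M" if "i \<in> I" for i
      using that e Ac[OF c] by (auto simp: v_def I_def)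
    have finI: "finite I" by (simp add: I_def)
    \<comment> \<open>\<open>T\<close> is m times the submodule spanned by the family
      \<open>v\<close>; the aim is that it contains the family itself.\<close>
    define T where "T = {\<Oplus>\<^bsub>M\<^esub> j\<in>I. f j \<odot>\<^bsub>M\<^esub> v j | f. \<forall>j\<in>I. f j \<in> m}"
    have T0: "\<zero>\<^bsub>M\<^esub> \<in> T"
    proof -
      have "(\<Oplus>\<^bsub>M\<^esub> j\<in>I. \<zero>\<^bsub>R\<^esub> \<odot>\<^bsub>M\<^esub> v j) = \<zero>\<^bsub>M\<^esub>"
        by (rule M.add.finprod_one_eqI) (use v in auto)
      then show ?thesis unfolding T_def by (intro CollectI exI[of _ "\<lambda>_. \<zero>\<^bsub>R\<^esub>"]) auto
    qed
    have Tadd: "r \<oplus>\<^bsub>M\<^esub> s \<in> T" if "r \<in> T" "s \<in> T" for r s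
    proof -
      from that obtain f h where r: "r = (\<Oplus>\<^bsub>M\<^esub> j\<in>I. f j \<odot>\<^bsub>M\<^esub> v j)" and s: "s = (\<Oplus>\<^bsub>M\<^esub> j\<in>I. h j \<odot>\<^bsub>M\<^esub> v j)"
        and m: "\<And>j. j \<in> I \<Longrightarrow> f j \<in> m" "\<And>j. j \<in> I \<Longrightarrow> h j \<in> m" unfolding T_def by blast
      have "r \<oplus>\<^bsub>M\<^esub> s = (\<Oplus>\<^bsub>M\<^esub> j\<in>I. f j \<odot>\<^bsub>M\<^esub> v j \<oplus>\<^bsub>M\<^esub> h j \<odot>\<^bsub>M\<^esub> v j)"
        unfolding r s by (rule M.finsum_addf[symmetric]) (use m m_carrier v in auto)
      also have "\<dots> = (\<Oplus>\<^bsub>M\<^esub> j\<in>I. (f j \<oplus>\<^bsub>R\<^esub> h j) \<odot>\<^bsub>M\<^esub> v j)"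
        by (rule M.finsum_cong') (use m m_carrier v in \<open>auto simp: smult_l_distr\<close>)
      finally show ?thesis unfolding T_def using m by (auto intro!: exI[of _ "\<lambda>j. f j \<oplus>\<^bsub>R\<^esub> h j"] m.a_closed)
    qed
    have Tel: "a \<odot>\<^bsub>M\<^esub> v i \<in> T" if "a \<in> m" "i \<in> I" for a i
    proof -
      have "(\<Oplus>\<^bsub>M\<^esub> j\<in>I. (if j = i then a else \<zero>\<^bsub>R\<^esub>) \<odot>\<^bsub>M\<^esub> v j)
          = (\<Oplus>\<^bsub>M\<^esub> j\<in>I. if i = j then a \<odot>\<^bsub>M\<^esub> v j else \<zero>\<^bsub>M\<^esub>)"
        by (rule M.finsum_cong') (use that v m_carrier in auto)
      also have "\<dots> = a \<odot>\<^bsub>M\<^esub> v i"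
        by (rule M.finsum_singleton) (use that v m_carrier finI in auto)
      finally show ?thesis unfolding T_def using that
        by (intro CollectI exI[of _ "\<lambda>j. if j = i then a else \<zero>\<^bsub>R\<^esub>"]) auto
    qed
    have "v i \<in> T" if i: "i \<in> I" for i
    proof -
      obtain k l where kl: "i = (k, l)" "k < p" "l < g" using i by (auto simp: I_def)
      \<comment> \<open>The vector with \<open>e l\<close> in place \<open>k\<close> is chosen
        because entry \<open>c\<close> of its image is \<open>v (k, l)\<close>; \<open>img\<close>
        then allows it to be replaced by one with entries in mM.\<close>
      have d: "(\<lambda>j. if j = k then e l else \<zero>\<^bsub>M\<^esub>) \<in> vecs M p" using kl e by (auto intro: delta_vecs)
      obtain w' where w': "w' \<in> vecs M p" "\<And>j. j < p \<Longrightarrow> w' j \<in> mM"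
        and eq: "mat_act M A p q (\<lambda>j. if j = k then e l else \<zero>\<^bsub>M\<^esub>) = mat_act M A p q w'"
        using img[OF d] by blast
      have "v i = lincomb M (A c) (\<lambda>j. if j = k then e l else \<zero>\<^bsub>M\<^esub>) p"
        using lincomb_delta_r[of k p "e l" "A c"] kl e Ac[OF c] by (simp add: v_def)
      also have "\<dots> = lincomb M (A c) w' p"
        using fun_cong[OF eq, of c] c by (simp add: mat_act_lincomb)
      also have "\<dots> \<in> T"
      proof (rule lincomb_in[OF T0 Tadd])
        fix j assume j: "j < p"
        show "A c j \<in> carrier R" using Ac c j by blast
        show "w' j \<in> carrier M" using w' j by (blast intro: vecsD)
        obtain a where a: "\<And>l. l < g \<Longrightarrow> a l \<in> m" "w' j = lincomb M a e g"
          using mM_generators[OF e gen w'(2)[OF j]] by blast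
        have "A c j \<odot>\<^bsub>M\<^esub> w' j = lincomb M a (\<lambda>l. A c j \<odot>\<^bsub>M\<^esub> e l) g"
          unfolding a(2) by (rule lincomb_smult_r[symmetric]) (use Ac[OF c] j a m_carrier e in auto)
        also have "\<dots> \<in> T"
        proof (rule lincomb_in[OF T0 Tadd])
          fix l assume l: "l < g"
          show "a l \<in> carrier R" using a l m_carrier by blast
          show "A c j \<odot>\<^bsub>M\<^esub> e l \<in> carrier M" using Ac[OF c] j e l by auto
          show "a l \<odot>\<^bsub>M\<^esub> (A c j \<odot>\<^bsub>M\<^esub> e l) \<in> T"
            using Tel[of "a l" "(j, l)"] a l j by (simp add: v_def I_def)
        qed
        finally show "A c j \<odot>\<^bsub>M\<^esub> w' j \<in> T" .
      qed
      finally show ?thesis .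
    qed
    then have "\<forall>i\<in>I. \<exists>f. (\<forall>j\<in>I. f j \<in> m) \<and> v i = (\<Oplus>\<^bsub>M\<^esub> j\<in>I. f j \<odot>\<^bsub>M\<^esub> v j)"
      unfolding T_def by blast
    then obtain a where a: "\<forall>i\<in>I. (\<forall>j\<in>I. a i j \<in> m) \<and> v i = (\<Oplus>\<^bsub>M\<^esub> j\<in>I. a i j \<odot>\<^bsub>M\<^esub> v j)"
      by (subst (asm) bchoice_iff) blast
    have kl: "(k, l) \<in> I" using that by (simp add: I_def)
    have "v (k, l) = \<zero>\<^bsub>M\<^esub>"
      by (rule nakayama[where a = a, OF finI v _ _ kl]) (use a in blast)+
    then show ?thesis by (simp add: v_def)
  qed
  have kill: "A c k \<odot>\<^bsub>M\<^esub> y = \<zero>\<^bsub>M\<^esub>" if "c < q" "k < p" and y: "y \<in> carrier M" for c k y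
  proof -
    obtain b where b: "b \<in> vecs (ring_module R) g" "y = lincomb M b e g"
      using gen y by blast
    have bc: "b l \<in> carrier R" for l using b(1) by (rule vecs_S_carrier)
    have "A c k \<odot>\<^bsub>M\<^esub> y = lincomb M b (\<lambda>l. A c k \<odot>\<^bsub>M\<^esub> e l) g"
      unfolding b(2) by (rule lincomb_smult_r[symmetric]) (use Ac that(1,2) bc e in auto)
    also have "\<dots> = \<zero>\<^bsub>M\<^esub>" by (rule lincomb_zero_r) (use kill_gen that(1,2) bc in auto)
    finally show ?thesis .
  qed
  show ?thesis
  proof
    fix c
    have "(\<Oplus>\<^bsub>M\<^esub> j\<in>{..<p}. A c j \<odot>\<^bsub>M\<^esub> w j) = \<zero>\<^bsub>M\<^esub>" if "c < q"
      by (rule M.add.finprod_one_eqI) (use kill[OF that] vecsD[OF w] in auto)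
    then show "mat_act M A p q w c = \<zero>\<^bsub>M\<^esub>" by (simp add: mat_act_def)
  qed
qed

text \<open>\<open>Z\<close> plays the cycles, but only closure properties are assumed: pivoting
  replaces it by the cycles with one vanishing entry, and the outgoing map never has to be
  rewritten. The sixth hypothesis is exactness on mM. The induction is on the number of nonzero
  columns of \<open>A\<close>, which drops with each pivot; once all entries lie in
  \<open>m\<close>, Nakayama concludes.\<close>

lemma exact_descent:
  assumes "mat_over R A p q" "Z \<subseteq> vecs M q"
    and "\<And>u v. u \<in> Z \<Longrightarrow> v \<in> Z \<Longrightarrow> (\<lambda>i. u i \<ominus>\<^bsub>M\<^esub> v i) \<in> Z"
    and "\<And>a u. a \<in> carrier R \<Longrightarrow> u \<in> Z \<Longrightarrow> (\<lambda>i. a \<odot>\<^bsub>M\<^esub> u i) \<in> Z"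
    and "\<And>w. w \<in> vecs M p \<Longrightarrow> mat_act M A p q w \<in> Z"
    and "\<And>u. u \<in> Z \<Longrightarrow> (\<And>i. i < q \<Longrightarrow> u i \<in> mM) \<Longrightarrow>
      \<exists>w\<in>vecs M p. (\<forall>j<p. w j \<in> mM) \<and> u = mat_act M A p q w"
    and "u \<in> Z"
  shows "\<exists>w\<in>vecs M p. u = mat_act M A p q w"
  using assms
proof (induction "card {j. j < p \<and> (\<exists>k<q. A k j \<noteq> \<zero>\<^bsub>R\<^esub>)}" arbitrary: A Z u rule: less_induct)
  case less
  note A = less.prems(1) and Zv = less.prems(2) and Zminus = less.prems(3) and Zsmult = less.prems(4)
    and AZ = less.prems(5) and mex = less.prems(6) and uZ = less.prems(7)
  show ?case
  proof (cases "\<forall>k<q. \<forall>j<p. A k j \<in> m")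
    case True
    have img: "\<exists>w'\<in>vecs M p. (\<forall>j<p. w' j \<in> mM) \<and> mat_act M A p q w = mat_act M A p q w'"
      if w: "w \<in> vecs M p" for w
    proof (rule mex[OF AZ[OF w]])
      fix i assume "i < q"
      then have "mat_act M A p q w i = lincomb M (A i) w p" by (simp add: mat_act_lincomb)
      moreover have "\<forall>j<p. A i j \<in> m \<and> w j \<in> carrier M" using \<open>i < q\<close> True w vecsD by blast
      ultimately show "mat_act M A p q w i \<in> mM" unfolding ideal_times_def by blast
    qed
    have zero: "mat_act M A p q w = (\<lambda>_. \<zero>\<^bsub>M\<^esub>)" if "w \<in> vecs M p" for w
      by (rule mat_act_eq_zero) (use True img that in auto)
    have x: "x \<in> carrier R" using xm by (rule m_carrier)
    have u: "u \<in> vecs M q" using uZ Zv by blast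
    have "\<exists>w\<in>vecs M p. (\<forall>j<p. w j \<in> mM) \<and> (\<lambda>i. x \<odot>\<^bsub>M\<^esub> u i) = mat_act M A p q w"
      by (rule mex[OF Zsmult[OF x uZ]])
        (use u xm m.a_subset vecs_carrier in \<open>auto intro!: smult_ideal_times\<close>)
    then have "(\<lambda>i. x \<odot>\<^bsub>M\<^esub> u i) = (\<lambda>_. \<zero>\<^bsub>M\<^esub>)" using zero by auto
    then have "u i = \<zero>\<^bsub>M\<^esub>" for i
      using regular[of "u i"] u vecs_carrier by (auto dest: fun_cong[of _ _ i])
    then have "u = (\<lambda>_. \<zero>\<^bsub>M\<^esub>)" by auto
    then show ?thesis using zero[OF zero_vecs] zero_vecs by metis
  next
    case False
    then obtain k j where k: "k < q" and j: "j < p" and nm: "A k j \<notin> m" by blast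
    have Ac: "A i l \<in> carrier R" if "i < q" "l < p" for i l using A that by (rule mat_overD)
    obtain c where c: "c \<in> carrier R" and inv: "A k j \<otimes>\<^bsub>R\<^esub> c = \<one>\<^bsub>R\<^esub>"
      using unit_outside_maximal[OF local Ac[OF k j] nm] unfolding Units_def by auto
    \<comment> \<open>Pivoting on the unit \<open>A k j\<close> kills row \<open>k\<close> and column \<open>j\<close>; correspondingly only cycles
      with vanishing \<open>k\<close>-th entry need to be considered.\<close>
    define A' where "A' i l = A i l \<ominus>\<^bsub>R\<^esub> (A i j \<otimes>\<^bsub>R\<^esub> c) \<otimes>\<^bsub>R\<^esub> A k l" for i l
    define Z' where "Z' = {u \<in> Z. u k = \<zero>\<^bsub>M\<^esub>}"
    define \<delta> where "\<delta> y = (\<lambda>i. if i = j then y else \<zero>\<^bsub>M\<^esub>)" for y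
    \<comment> \<open>\<open>\<tau>\<close> corrects coordinate \<open>j\<close> by the amount that
      makes entry \<open>k\<close> of the image vanish; \<open>A'\<close> is the matrix of
      \<open>A\<close> composed with \<open>\<tau>\<close>.\<close>
    define \<tau> where "\<tau> w = (\<lambda>i. w i \<ominus>\<^bsub>M\<^esub> \<delta> (c \<odot>\<^bsub>M\<^esub> mat_act M A p q w k) i)" for w
    have \<delta>v: "\<delta> y \<in> vecs M p" if "y \<in> carrier M" for y
      unfolding \<delta>_def using j that by (rule delta_vecs)
    have A\<delta>: "mat_act M A p q (\<delta> y) i = A i j \<odot>\<^bsub>M\<^esub> y" if "i < q" "y \<in> carrier M" for i y
      using lincomb_delta_r[OF j that(2), of "A i"] that Ac by (simp add: mat_act_lincomb \<delta>_def)
    have Av: "mat_act M A p q w \<in> vecs M q" if "w \<in> vecs M p" for w using A that by (rule mat_act_closed)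
    have \<tau>v: "\<tau> w \<in> vecs M p" if "w \<in> vecs M p" for w
      unfolding \<tau>_def by (intro minus_vecs \<delta>v smult_closed c that vecs_carrier[OF Av])
    have A'c: "mat_over R A' p q" unfolding mat_over_def A'_def using Ac k j c by auto
    have A\<tau>: "mat_act M A p q (\<tau> w) i = mat_act M A p q w i \<ominus>\<^bsub>M\<^esub> (A i j \<otimes>\<^bsub>R\<^esub> c) \<odot>\<^bsub>M\<^esub> mat_act M A p q w k"
      if w: "w \<in> vecs M p" and i: "i < q" for w i
    proof -
      have y: "mat_act M A p q w k \<in> carrier M" using Av[OF w] by (rule vecs_carrier)
      then have "mat_act M A p q (\<tau> w) i
          = mat_act M A p q w i \<ominus>\<^bsub>M\<^esub> mat_act M A p q (\<delta> (c \<odot>\<^bsub>M\<^esub> mat_act M A p q w k)) i"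
        unfolding \<tau>_def using mat_act_minus[OF A w \<delta>v] c by simp
      also have "mat_act M A p q (\<delta> (c \<odot>\<^bsub>M\<^esub> mat_act M A p q w k)) i
          = (A i j \<otimes>\<^bsub>R\<^esub> c) \<odot>\<^bsub>M\<^esub> mat_act M A p q w k"
        using A\<delta>[OF i, of "c \<odot>\<^bsub>M\<^esub> mat_act M A p q w k"] c y Ac[OF i j] by (simp add: smult_assoc1)
      finally show ?thesis .
    qed
    have A'\<tau>: "mat_act M A' p q w = mat_act M A p q (\<tau> w)" if w: "w \<in> vecs M p" for w
    proof (rule vecs_ext)
      show "mat_act M A' p q w \<in> vecs M q" using A'c w by (rule mat_act_closed)
      show "mat_act M A p q (\<tau> w) \<in> vecs M q" using \<tau>v[OF w] by (rule Av)
      fix i assume i: "i < q"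
      have "mat_act M A' p q w i = lincomb M (\<lambda>l. A i l \<ominus>\<^bsub>R\<^esub> (A i j \<otimes>\<^bsub>R\<^esub> c) \<otimes>\<^bsub>R\<^esub> A k l) w p"
        using i by (simp add: mat_act_lincomb A'_def[abs_def])
      also have "\<dots> = lincomb M (A i) w p \<ominus>\<^bsub>M\<^esub> lincomb M (\<lambda>l. (A i j \<otimes>\<^bsub>R\<^esub> c) \<otimes>\<^bsub>R\<^esub> A k l) w p"
        by (rule lincomb_minus_l) (use Ac i j k c w vecsD in auto)
      also have "lincomb M (\<lambda>l. (A i j \<otimes>\<^bsub>R\<^esub> c) \<otimes>\<^bsub>R\<^esub> A k l) w p = (A i j \<otimes>\<^bsub>R\<^esub> c) \<odot>\<^bsub>M\<^esub> lincomb M (A k) w p"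
        by (rule lincomb_smult_l) (use Ac i j k c w vecsD in auto)
      finally show "mat_act M A' p q w i = mat_act M A p q (\<tau> w) i"
        using A\<tau>[OF w i] i k by (simp add: mat_act_lincomb)
    qed
    have rowk: "mat_act M A p q (\<tau> w) k = \<zero>\<^bsub>M\<^esub>" if w: "w \<in> vecs M p" for w
      using A\<tau>[OF w k] vecs_carrier[OF Av[OF w]] by (simp add: inv minus_self)
    have colj: "A' i j = \<zero>\<^bsub>R\<^esub>" if "i < q" for i
    proof -
      have "(A i j \<otimes>\<^bsub>R\<^esub> c) \<otimes>\<^bsub>R\<^esub> A k j = A i j \<otimes>\<^bsub>R\<^esub> (A k j \<otimes>\<^bsub>R\<^esub> c)"
        using Ac j k c that by (simp add: R.m_assoc R.m_comm[of c])
      then show ?thesis using Ac[OF that j] S.minus_self[of "A i j"] by (simp add: A'_def inv)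
    qed
    have zero_col: "A' i l = \<zero>\<^bsub>R\<^esub>" if "\<And>i. i < q \<Longrightarrow> A i l = \<zero>\<^bsub>R\<^esub>" "i < q" "l < p" for i l
      using that Ac[OF that(2) j] c k S.minus_self[of "\<zero>\<^bsub>R\<^esub>"] by (simp add: A'_def)
    \<comment> \<open>Zero columns stay zero, and column \<open>j\<close>, which contained the unit,
      becomes zero.\<close>
    have sub: "{l. l < p \<and> (\<exists>i<q. A' i l \<noteq> \<zero>\<^bsub>R\<^esub>)} \<subset> {l. l < p \<and> (\<exists>i<q. A i l \<noteq> \<zero>\<^bsub>R\<^esub>)}"
    proof (rule psubsetI)
      show "{l. l < p \<and> (\<exists>i<q. A' i l \<noteq> \<zero>\<^bsub>R\<^esub>)} \<subseteq> {l. l < p \<and> (\<exists>i<q. A i l \<noteq> \<zero>\<^bsub>R\<^esub>)}"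
        using zero_col by blast
      have "A k j \<noteq> \<zero>\<^bsub>R\<^esub>" using nm m.zero_closed by auto
      then show "{l. l < p \<and> (\<exists>i<q. A' i l \<noteq> \<zero>\<^bsub>R\<^esub>)} \<noteq> {l. l < p \<and> (\<exists>i<q. A i l \<noteq> \<zero>\<^bsub>R\<^esub>)}"
        using j k colj by blast
    qed
    have fin: "finite {l. l < p \<and> (\<exists>i<q. A i l \<noteq> \<zero>\<^bsub>R\<^esub>)}" by simp
    have u: "u \<in> vecs M q" using uZ Zv by blast
    have cu: "c \<odot>\<^bsub>M\<^esub> u k \<in> carrier M" using c vecs_carrier[OF u] by simp
    \<comment> \<open>Subtracting a boundary keeps \<open>u\<close> a cycle; this one has entry
      \<open>u k\<close> in place \<open>k\<close>, because \<open>c\<close> inverts the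
      pivot.\<close>
    define u' where "u' = (\<lambda>i. u i \<ominus>\<^bsub>M\<^esub> mat_act M A p q (\<delta> (c \<odot>\<^bsub>M\<^esub> u k)) i)"
    have u'Z: "u' \<in> Z" unfolding u'_def by (intro Zminus uZ AZ \<delta>v cu)
    have "u' k = \<zero>\<^bsub>M\<^esub>"
      using A\<delta>[OF k cu] c Ac[OF k j] vecs_carrier[OF u]
      by (simp add: u'_def smult_assoc1[symmetric] inv minus_self)
    with u'Z have "u' \<in> Z'" by (simp add: Z'_def)
    have "\<exists>w\<in>vecs M p. u' = mat_act M A' p q w"
    proof (rule less.hyps[OF psubset_card_mono[OF fin sub] A'c])
      show "Z' \<subseteq> vecs M q" using Zv by (auto simp: Z'_def)
      show "(\<lambda>i. u i \<ominus>\<^bsub>M\<^esub> v i) \<in> Z'" if "u \<in> Z'" "v \<in> Z'" for u v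
        using that Zminus by (auto simp: Z'_def minus_self)
      show "(\<lambda>i. a \<odot>\<^bsub>M\<^esub> u i) \<in> Z'" if "a \<in> carrier R" "u \<in> Z'" for a u
        using that Zsmult by (auto simp: Z'_def)
      show "mat_act M A' p q w \<in> Z'" if "w \<in> vecs M p" for w
        using that A'\<tau> rowk AZ[OF \<tau>v] by (auto simp: Z'_def)
      show "u' \<in> Z'" by fact
      fix v assume v: "v \<in> Z'" "\<And>i. i < q \<Longrightarrow> v i \<in> mM"
      obtain w where w: "w \<in> vecs M p" "\<forall>j<p. w j \<in> mM" "v = mat_act M A p q w"
        using mex[of v] v by (auto simp: Z'_def)
      \<comment> \<open>Entry \<open>k\<close> of \<open>v\<close> is zero, so the correction is
        zero: the preimage with entries in mM found for \<open>A\<close> serves unchanged for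
        \<open>A'\<close>.\<close>
      have "\<tau> w = w"
        using v(1) w c vecs_carrier[OF w(1)]
        by (intro ext) (auto simp: \<tau>_def Z'_def \<delta>_def a_minus_def M.add.inv_one)
      then show "\<exists>w\<in>vecs M p. (\<forall>j<p. w j \<in> mM) \<and> v = mat_act M A' p q w"
        using w A'\<tau>[OF w(1)] by auto
    qed
    then obtain w where w: "w \<in> vecs M p" "u' = mat_act M A' p q w" by blast
    have "u = mat_act M A p q (\<lambda>i. \<tau> w i \<oplus>\<^bsub>M\<^esub> \<delta> (c \<odot>\<^bsub>M\<^esub> u k) i)"
    proof
      fix i
      have "mat_act M A p q (\<lambda>i. \<tau> w i \<oplus>\<^bsub>M\<^esub> \<delta> (c \<odot>\<^bsub>M\<^esub> u k) i) i
          = u' i \<oplus>\<^bsub>M\<^esub> mat_act M A p q (\<delta> (c \<odot>\<^bsub>M\<^esub> u k)) i"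
        using mat_act_add[OF A \<tau>v[OF w(1)] \<delta>v[OF cu]] w A'\<tau> by simp
      also have "\<dots> = u i"
        using vecs_carrier[OF u] vecs_carrier[OF Av[OF \<delta>v[OF cu]]]
        by (simp add: u'_def a_minus_def M.a_assoc M.l_neg)
      finally show "u i = mat_act M A p q (\<lambda>i. \<tau> w i \<oplus>\<^bsub>M\<^esub> \<delta> (c \<odot>\<^bsub>M\<^esub> u k) i) i" by simp
    qed
    then show ?thesis using add_vecs[OF \<tau>v[OF w(1)] \<delta>v[OF cu]] by blast
  qed
qed

end

section \<open>Finite generation and free resolutions over Noetherian rings\<close>

text \<open>Submodules of R^b, spelled out on functions because R^b itself is not set up as a module
  record. Negatives come from the scalar -1.\<close>

definition vec_submodule :: "'a ring \<Rightarrow> nat \<Rightarrow> (nat \<Rightarrow> 'a) set \<Rightarrow> bool" where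
  "vec_submodule R b K \<longleftrightarrow> K \<subseteq> vecs (ring_module R) b \<and> (\<lambda>_. \<zero>\<^bsub>R\<^esub>) \<in> K \<and>
     (\<forall>u\<in>K. \<forall>v\<in>K. (\<lambda>i. u i \<oplus>\<^bsub>R\<^esub> v i) \<in> K) \<and>
     (\<forall>a\<in>carrier R. \<forall>u\<in>K. (\<lambda>i. a \<otimes>\<^bsub>R\<^esub> u i) \<in> K)"

lemma vec_submoduleD:
  assumes "vec_submodule R b K"
  shows "K \<subseteq> vecs (ring_module R) b" "(\<lambda>_. \<zero>\<^bsub>R\<^esub>) \<in> K"
    "u \<in> K \<Longrightarrow> v \<in> K \<Longrightarrow> (\<lambda>i. u i \<oplus>\<^bsub>R\<^esub> v i) \<in> K"
    "a \<in> carrier R \<Longrightarrow> u \<in> K \<Longrightarrow> (\<lambda>i. a \<otimes>\<^bsub>R\<^esub> u i) \<in> K"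
  using assms by (auto simp: vec_submodule_def)

locale noetherian_cring = cring R + noetherian_ring R for R :: "'a ring"

sublocale noetherian_cring \<subseteq> S: basic_module R "ring_module R"
  using module_ring_module[OF is_cring] by (simp add: basic_module_def)

context noetherian_cring
begin

lemma vec_submodule_carrier:
  "vec_submodule R b K \<Longrightarrow> u \<in> K \<Longrightarrow> u i \<in> carrier R"
  using S.vecs_S_carrier vec_submoduleD(1) by blast

lemma vec_submodule_ideal:
  assumes T: "vec_submodule R b T"
  shows "ideal ((\<lambda>c. c k) ` T) R"
proof (rule idealI[OF ring_axioms])
  note D = vec_submoduleD[OF T] and c = vec_submodule_carrier[OF T]
  have sm: "a \<otimes>\<^bsub>R\<^esub> y \<in> (\<lambda>c. c k) ` T" if "a \<in> carrier R" "y \<in> (\<lambda>c. c k) ` T" for a y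
    using D(4) that by force
  show "subgroup ((\<lambda>c. c k) ` T) (add_monoid R)"
  proof (rule add.subgroupI)
    show "(\<lambda>c. c k) ` T \<subseteq> carrier R" using c by auto
    show "(\<lambda>c. c k) ` T \<noteq> {}" using D(2) by auto
    fix y assume y: "y \<in> (\<lambda>c. c k) ` T"
    then have "\<ominus>\<^bsub>R\<^esub> y = (\<ominus>\<^bsub>R\<^esub> \<one>\<^bsub>R\<^esub>) \<otimes>\<^bsub>R\<^esub> y" using c by (auto simp: l_minus)
    also have "\<dots> \<in> (\<lambda>c. c k) ` T" by (rule sm) (use y in auto)
    finally show "\<ominus>\<^bsub>R\<^esub> y \<in> (\<lambda>c. c k) ` T" .
    fix z assume "z \<in> (\<lambda>c. c k) ` T"
    with y D(3) show "y \<oplus>\<^bsub>R\<^esub> z \<in> (\<lambda>c. c k) ` T" by force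
  qed
  fix a y assume a: "a \<in> (\<lambda>c. c k) ` T" and y: "y \<in> carrier R"
  show "y \<otimes>\<^bsub>R\<^esub> a \<in> (\<lambda>c. c k) ` T" using a y by (intro sm)
  then show "a \<otimes>\<^bsub>R\<^esub> y \<in> (\<lambda>c. c k) ` T" using a y c by (auto simp: m_comm)
qed

lemma vec_submodule_Int:
  "vec_submodule R b K \<Longrightarrow> vec_submodule R b T \<Longrightarrow> vec_submodule R b (K \<inter> T)"
  by (auto simp: vec_submodule_def)

lemma vec_submodule_restrict:
  assumes "vec_submodule R (Suc b) K"
  shows "vec_submodule R b {c \<in> K. c b = \<zero>\<^bsub>R\<^esub>}"
proof -
  have "c \<in> vecs (ring_module R) b" if "c \<in> vecs (ring_module R) (Suc b)" "c b = \<zero>\<^bsub>R\<^esub>" for c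
    using that unfolding vecs_def by (auto simp: not_less_eq_eq[symmetric]) (metis le_antisym not_less_eq_eq)
  with assms show ?thesis unfolding vec_submodule_def by auto
qed

text \<open>R^b is Noetherian, by induction on \<open>b\<close>: generators of the vectors with last
  coordinate zero are joined with lifts of generators of the ideal of last coordinates. Generation
  is phrased as minimality among submodules, so no linear combinations over an unindexed finite set
  are needed.\<close>

lemma vec_submodule_finite:
  "vec_submodule R b K \<Longrightarrow> \<exists>G. finite G \<and> G \<subseteq> K \<and> (\<forall>T. vec_submodule R b T \<longrightarrow> G \<subseteq> T \<longrightarrow> K \<subseteq> T)"
proof (induction b arbitrary: K)
  case 0
  have "vecs (ring_module R) 0 = {\<lambda>_. \<zero>\<^bsub>R\<^esub>}" by (auto simp: vecs_def)
  then have "K \<subseteq> T" if "vec_submodule R 0 T" for T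
    using vec_submoduleD(1)[OF 0] vec_submoduleD(2)[OF that] by auto
  then show ?case by (intro exI[of _ "{}"]) auto
next
  case (Suc b)
  note K = vec_submoduleD[OF Suc.prems] and Kc = vec_submodule_carrier[OF Suc.prems]
  obtain G where G: "finite G" "G \<subseteq> {c \<in> K. c b = \<zero>\<^bsub>R\<^esub>}"
    and GT: "\<And>T. vec_submodule R b T \<Longrightarrow> G \<subseteq> T \<Longrightarrow> {c \<in> K. c b = \<zero>\<^bsub>R\<^esub>} \<subseteq> T"
    using Suc.IH[OF vec_submodule_restrict[OF Suc.prems]] by blast
  obtain A where A: "finite A" "A \<subseteq> carrier R" "(\<lambda>c. c b) ` K = Idl\<^bsub>R\<^esub> A"
    using finetely_gen[OF vec_submodule_ideal[OF Suc.prems, of b]] by blast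
  then have "A \<subseteq> (\<lambda>c. c b) ` K" using genideal_self[of A] by simp
  then obtain H where H: "H \<subseteq> K" "finite H" "A = (\<lambda>c. c b) ` H"
    using A(1) by (meson finite_subset_image)
  show ?case
  proof (intro exI[of _ "H \<union> G"] conjI allI impI)
    show "finite (H \<union> G)" "H \<union> G \<subseteq> K" using H G by auto
    fix T assume T: "vec_submodule R (Suc b) T" "H \<union> G \<subseteq> T"
    have KT: "vec_submodule R (Suc b) (K \<inter> T)" using Suc.prems T(1) by (rule vec_submodule_Int)
    have "A \<subseteq> (\<lambda>c. c b) ` (K \<inter> T)" using H T by auto
    \<comment> \<open>The last coordinates of the vectors in both \<open>K\<close> and
      \<open>T\<close> form an ideal that contains the generators \<open>A\<close>, hence every last
      coordinate occurring in \<open>K\<close>.\<close>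
    then have img: "(\<lambda>c. c b) ` K \<subseteq> (\<lambda>c. c b) ` (K \<inter> T)"
      unfolding A(3) by (rule genideal_minimal[OF vec_submodule_ideal[OF KT]])
    have ker: "{c \<in> K. c b = \<zero>\<^bsub>R\<^esub>} \<subseteq> {c \<in> T. c b = \<zero>\<^bsub>R\<^esub>}"
      by (rule GT[OF vec_submodule_restrict[OF T(1)]]) (use G T in auto)
    show "K \<subseteq> T"
    proof
      fix c assume c: "c \<in> K"
      then have "c b \<in> (\<lambda>c. c b) ` (K \<inter> T)" using img by blast
      then obtain c' where c': "c b = c' b" "c' \<in> K" "c' \<in> T" by blast
      define v where "v = (\<lambda>i. c i \<oplus>\<^bsub>R\<^esub> (\<ominus>\<^bsub>R\<^esub> \<one>\<^bsub>R\<^esub>) \<otimes>\<^bsub>R\<^esub> c' i)"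
      have "v \<in> K" unfolding v_def using K(3)[OF c K(4)[OF _ c'(2)]] by simp
      moreover have "v b = \<zero>\<^bsub>R\<^esub>" using Kc[OF c'(2)] c' by (simp add: v_def l_minus r_neg)
      ultimately have "v \<in> T" using ker by blast
      then have "(\<lambda>i. v i \<oplus>\<^bsub>R\<^esub> c' i) \<in> T" using c'(3) by (intro vec_submoduleD(3)[OF T(1)])
      also have "(\<lambda>i. v i \<oplus>\<^bsub>R\<^esub> c' i) = c"
        using Kc[OF c] Kc[OF c'(2)] by (auto simp: v_def l_minus a_assoc l_neg)
      finally show "c \<in> T" .
    qed
  qed
qed

lemma vec_submodule_image:
  assumes D: "mat_over R D p b"
  shows "vec_submodule R b (mat_act (ring_module R) D p b ` vecs (ring_module R) p)"
  unfolding vec_submodule_def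
proof (intro conjI ballI)
  show "mat_act (ring_module R) D p b ` vecs (ring_module R) p \<subseteq> vecs (ring_module R) b"
    using S.mat_act_closed[OF D] by auto
  show "(\<lambda>_. \<zero>\<^bsub>R\<^esub>) \<in> mat_act (ring_module R) D p b ` vecs (ring_module R) p"
    using S.mat_act_zero[OF D] S.zero_vecs[of p] by (metis imageI ring_module_simps(2))
next
  fix u v assume "u \<in> mat_act (ring_module R) D p b ` vecs (ring_module R) p"
    "v \<in> mat_act (ring_module R) D p b ` vecs (ring_module R) p"
  then obtain u' v' where uv: "u = mat_act (ring_module R) D p b u'" "v = mat_act (ring_module R) D p b v'"
    "u' \<in> vecs (ring_module R) p" "v' \<in> vecs (ring_module R) p" by blast
  show "(\<lambda>i. u i \<oplus>\<^bsub>R\<^esub> v i) \<in> mat_act (ring_module R) D p b ` vecs (ring_module R) p"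
    using imageI[OF S.add_vecs[OF uv(3,4)], of "mat_act (ring_module R) D p b"]
    unfolding uv(1,2) S.mat_act_add[OF D uv(3,4)] by simp
next
  fix a u assume a: "a \<in> carrier R" and "u \<in> mat_act (ring_module R) D p b ` vecs (ring_module R) p"
  then obtain u' where u: "u = mat_act (ring_module R) D p b u'" "u' \<in> vecs (ring_module R) p" by blast
  show "(\<lambda>i. a \<otimes>\<^bsub>R\<^esub> u i) \<in> mat_act (ring_module R) D p b ` vecs (ring_module R) p"
    using imageI[OF S.smult_vecs[OF a u(2)], of "mat_act (ring_module R) D p b"]
    unfolding u(1) S.mat_act_smult[OF D u(2) a] by simp
qed

text \<open>The columns of \<open>D\<close> are finitely many generators of \<open>K\<close>.
  Applied to kernels, this is the passage from one differential of a resolution to the next.\<close>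

lemma vec_submodule_mat:
  assumes K: "vec_submodule R b K"
  shows "\<exists>p D. mat_over R D p b \<and> K = mat_act (ring_module R) D p b ` vecs (ring_module R) p"
proof -
  note KD = vec_submoduleD[OF K] and Kc = vec_submodule_carrier[OF K]
  obtain G where G: "finite G" "G \<subseteq> K"
    and GT: "\<And>T. vec_submodule R b T \<Longrightarrow> G \<subseteq> T \<Longrightarrow> K \<subseteq> T"
    using vec_submodule_finite[OF K] by blast
  obtain p and f :: "nat \<Rightarrow> nat \<Rightarrow> 'a" where f: "G = f ` {i. i < p}"
    using G(1) by (metis finite_imp_nat_seg_image_inj_on)
  have fK: "f j \<in> K" if "j < p" for j using f G that by auto
  define D where "D k j = f j k" for k j
  have D: "mat_over R D p b" unfolding mat_over_def D_def using fK Kc by auto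
  have "G \<subseteq> mat_act (ring_module R) D p b ` vecs (ring_module R) p"
  proof
    fix g assume "g \<in> G"
    then obtain j where j: "j < p" "g = f j" using f by auto
    define \<delta> where "\<delta> = (\<lambda>i. if i = j then \<one>\<^bsub>R\<^esub> else \<zero>\<^bsub>R\<^esub>)"
    have \<delta>v: "\<delta> \<in> vecs (ring_module R) p" using S.delta_vecs[OF j(1), of "\<one>\<^bsub>R\<^esub>", unfolded ring_module_simps] by (simp add: \<delta>_def)
    have "mat_act (ring_module R) D p b \<delta> = g"
    proof (rule vecs_ext)
      show "mat_act (ring_module R) D p b \<delta> \<in> vecs (ring_module R) b" using D \<delta>v by (rule S.mat_act_closed)
      show "g \<in> vecs (ring_module R) b" using j fK KD(1) by blast
      fix k assume k: "k < b"
      have "lincomb (ring_module R) (D k) \<delta> p = D k j"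
        using S.lincomb_delta_r[OF j(1), of "\<one>\<^bsub>R\<^esub>" "D k", unfolded ring_module_simps] mat_overD[OF D k] j(1) by (simp add: \<delta>_def)
      then show "mat_act (ring_module R) D p b \<delta> k = g k" using k j by (simp add: mat_act_lincomb D_def)
    qed
    then show "g \<in> mat_act (ring_module R) D p b ` vecs (ring_module R) p" using \<delta>v by blast
  qed
  then have "K \<subseteq> mat_act (ring_module R) D p b ` vecs (ring_module R) p"
    by (rule GT[OF vec_submodule_image[OF D]])
  moreover have "mat_act (ring_module R) D p b w \<in> K" if w: "w \<in> vecs (ring_module R) p" for w
  proof -
    have wc: "w j \<in> carrier R" for j using w by (rule S.vecs_S_carrier)
    \<comment> \<open>Induction over the first \<open>n\<close> columns: column \<open>n\<close>
      contributes \<open>w n\<close> times the generator \<open>f n\<close>.\<close>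
    have "mat_act (ring_module R) D n b w \<in> K" if "n \<le> p" for n
      using that
    proof (induction n)
      case 0
      have "mat_act (ring_module R) D 0 b w = (\<lambda>_. \<zero>\<^bsub>R\<^esub>)"
        by (rule ext) (simp add: mat_act_lincomb S.lincomb_0)
      then show ?case using KD(2) by simp
    next
      case (Suc n)
      then have fn: "f n \<in> K" using fK by simp
      have "mat_act (ring_module R) D (Suc n) b w
          = (\<lambda>k. mat_act (ring_module R) D n b w k \<oplus>\<^bsub>R\<^esub> w n \<otimes>\<^bsub>R\<^esub> f n k)"
      proof
        fix k
        show "mat_act (ring_module R) D (Suc n) b w k
            = mat_act (ring_module R) D n b w k \<oplus>\<^bsub>R\<^esub> w n \<otimes>\<^bsub>R\<^esub> f n k"
        proof (cases "k < b")
          case True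
          have "lincomb (ring_module R) (D k) w (Suc n)
              = lincomb (ring_module R) (D k) w n \<oplus>\<^bsub>R\<^esub> D k n \<otimes>\<^bsub>R\<^esub> w n"
            using S.lincomb_Suc[of n "D k" w] mat_overD[OF D True] Suc.prems wc by simp
          also have "D k n \<otimes>\<^bsub>R\<^esub> w n = w n \<otimes>\<^bsub>R\<^esub> f n k"
            unfolding D_def using wc Kc[OF fn] by (rule m_comm[rotated])
          finally show ?thesis using True by (simp add: mat_act_lincomb)
        next
          case False
          then have "f n k = \<zero>\<^bsub>R\<^esub>" using vecs_zero[of "f n" "ring_module R" b k] fn KD(1) by auto
          then show ?thesis using False wc by (simp add: mat_act_lincomb)
        qed
      qed
      moreover have "mat_act (ring_module R) D n b w \<in> K" using Suc by simp
      ultimately show ?case using KD(3) KD(4)[OF wc fn] by simp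
    qed
    then show ?thesis by blast
  qed
  ultimately have "K = mat_act (ring_module R) D p b ` vecs (ring_module R) p" by blast
  with D show ?thesis by blast
qed

end

section \<open>Finite generation of submodules and existence of free resolutions\<close>

context basic_module
begin

text \<open>Used twice: with \<open>L\<close> zero it yields the first syzygies, and with general
  \<open>L\<close> the preimage whose generators map onto generators of \<open>L\<close>.\<close>

lemma kernel_vec_submodule:
  assumes e: "\<forall>j<b. e j \<in> carrier M" and L: "submodule L R M"
  shows "vec_submodule R b {c \<in> vecs (ring_module R) b. lincomb M c e b \<in> L}"
proof -
  note LE = submoduleE[OF L]
  have z: "\<zero>\<^bsub>M\<^esub> \<in> L" using LE(1,2,4) smult_l_null by (metis R.zero_closed ex_in_conv subsetD)
  show ?thesis
    unfolding vec_submodule_def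
  proof (intro conjI ballI)
    have "lincomb M (\<lambda>_. \<zero>\<^bsub>R\<^esub>) e b = \<zero>\<^bsub>M\<^esub>" by (rule lincomb_zero_l) (use e in auto)
    then show "(\<lambda>_. \<zero>\<^bsub>R\<^esub>) \<in> {c \<in> vecs (ring_module R) b. lincomb M c e b \<in> L}"
      using z S.zero_vecs[of b] by simp
  next
    fix u v assume uv: "u \<in> {c \<in> vecs (ring_module R) b. lincomb M c e b \<in> L}"
      "v \<in> {c \<in> vecs (ring_module R) b. lincomb M c e b \<in> L}"
    then have "lincomb M (\<lambda>i. u i \<oplus>\<^bsub>R\<^esub> v i) e b = lincomb M u e b \<oplus>\<^bsub>M\<^esub> lincomb M v e b"
      by (intro lincomb_add_l) (use e vecs_S_carrier in auto)
    then show "(\<lambda>i. u i \<oplus>\<^bsub>R\<^esub> v i) \<in> {c \<in> vecs (ring_module R) b. lincomb M c e b \<in> L}"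
      using uv LE(5) S.add_vecs[of u b v] by simp
  next
    fix a u assume a: "a \<in> carrier R" and u: "u \<in> {c \<in> vecs (ring_module R) b. lincomb M c e b \<in> L}"
    then have "lincomb M (\<lambda>i. a \<otimes>\<^bsub>R\<^esub> u i) e b = a \<odot>\<^bsub>M\<^esub> lincomb M u e b"
      by (intro lincomb_smult_l) (use e vecs_S_carrier in auto)
    then show "(\<lambda>i. a \<otimes>\<^bsub>R\<^esub> u i) \<in> {c \<in> vecs (ring_module R) b. lincomb M c e b \<in> L}"
      using a u LE(4) S.smult_vecs[OF a, of u b] by simp
  qed auto
qed

text \<open>\<open>finsum\<close> depends on the whole record, carrier included, so sums in the
  submodule are a priori different terms; the agreement is proved by adding one summand at a
  time.\<close>

lemma finsum_submodule:
  assumes L: "submodule L R M" and "finite A" "\<And>i. i \<in> A \<Longrightarrow> f i \<in> L"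
  shows "finsum (M\<lparr>carrier := L\<rparr>) f A = finsum M f A"
proof -
  interpret L: module R "M\<lparr>carrier := L\<rparr>"
    using submodule.submodule_is_module[OF L module_axioms] .
  have LM: "y \<in> L \<Longrightarrow> y \<in> carrier M" for y using submoduleE(1)[OF L] by blast
  show ?thesis using assms(2,3)
  proof (induction A rule: finite_induct)
    case empty
    then show ?case using L.M.finsum_empty M.finsum_empty by simp
  next
    case (insert i A)
    have "finsum (M\<lparr>carrier := L\<rparr>) f (insert i A)
        = f i \<oplus>\<^bsub>M\<lparr>carrier := L\<rparr>\<^esub> finsum (M\<lparr>carrier := L\<rparr>) f A"
      by (rule L.M.finsum_insert) (use insert in auto)
    also have "\<dots> = f i \<oplus>\<^bsub>M\<^esub> finsum M f A" using insert by simp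
    also have "\<dots> = finsum M f (insert i A)"
      by (rule M.finsum_insert[symmetric]) (use insert LM in auto)
    finally show ?case .
  qed
qed

lemma lincomb_submodule:
  assumes L: "submodule L R M" and "\<And>j. j < b \<Longrightarrow> c j \<in> carrier R" "\<And>j. j < b \<Longrightarrow> y j \<in> L"
  shows "lincomb (M\<lparr>carrier := L\<rparr>) c y b = lincomb M c y b"
proof -
  have "(\<Oplus>\<^bsub>M\<lparr>carrier := L\<rparr>\<^esub> j\<in>{..<b}. c j \<odot>\<^bsub>M\<^esub> y j) = (\<Oplus>\<^bsub>M\<^esub> j\<in>{..<b}. c j \<odot>\<^bsub>M\<^esub> y j)"
    by (rule finsum_submodule[OF L]) (use assms submoduleE(4)[OF L] in auto)
  then show ?thesis by (simp add: lincomb_def)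
qed

lemma mat_act_submodule:
  assumes L: "submodule L R M" and D: "mat_over R D p q" and u: "u \<in> vecs (M\<lparr>carrier := L\<rparr>) p"
  shows "mat_act (M\<lparr>carrier := L\<rparr>) D p q u = mat_act M D p q u"
proof
  fix k
  have "lincomb (M\<lparr>carrier := L\<rparr>) (D k) u p = lincomb M (D k) u p" if "k < q"
    by (rule lincomb_submodule[OF L]) (use mat_overD[OF D that] u in \<open>auto simp: vecs_def\<close>)
  then show "mat_act (M\<lparr>carrier := L\<rparr>) D p q u k = mat_act M D p q u k"
    by (simp add: mat_act_lincomb)
qed

lemma lincomb_ring_comm:
  assumes "\<And>j. j < p \<Longrightarrow> a j \<in> carrier R" "\<And>j. j < p \<Longrightarrow> c j \<in> carrier R"
  shows "lincomb (ring_module R) a c p = lincomb (ring_module R) c a p"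
  unfolding lincomb_def using assms by (intro S.M.finsum_cong') (auto simp: R.m_comm)

text \<open>The preimage of \<open>L\<close> in R^b is the image of a matrix \<open>D\<close>; the
  columns of \<open>D\<close>, sent to \<open>M\<close> by the generators \<open>e\<close>, generate
  \<open>L\<close>.\<close>

lemma submodule_fin_gen:
  assumes N: "noetherian_ring R" and fg: "fin_gen R M" and L: "submodule L R M"
  shows "fin_gen R (M\<lparr>carrier := L\<rparr>)"
proof -
  interpret N: noetherian_cring R using N R.is_cring by (simp add: noetherian_cring_def)
  obtain b e where e: "\<forall>j<b. e j \<in> carrier M"
    and gen: "\<forall>z\<in>carrier M. \<exists>c\<in>vecs (ring_module R) b. z = lincomb M c e b"
    using fg unfolding fin_gen_def by blast
  obtain p D where D: "mat_over R D p b"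
    and K: "{c \<in> vecs (ring_module R) b. lincomb M c e b \<in> L} = mat_act (ring_module R) D p b ` vecs (ring_module R) p"
    using N.vec_submodule_mat[OF kernel_vec_submodule[OF e L]] by blast
  define f where "f j = lincomb M (\<lambda>k. D k j) e b" for j
  have comp: "lincomb M (mat_act (ring_module R) D p b w) e b = lincomb M w f p"
    if w: "w \<in> vecs (ring_module R) p" for w
  proof -
    have wc: "w j \<in> carrier R" for j using w by (rule vecs_S_carrier)
    have Dw: "mat_act (ring_module R) D p b w \<in> vecs (ring_module R) b"
      using D w by (rule S.mat_act_closed)
    have "lincomb M w f p = lincomb M (\<lambda>i. lincomb (ring_module R) w (D i) p) e b"
      unfolding f_def by (rule lincomb_lincomb) (use wc e D mat_overD in auto)
    also have "\<dots> = lincomb M (mat_act (ring_module R) D p b w) e b"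
    proof (rule lincomb_cong)
      fix i assume i: "i < b"
      show "mat_act (ring_module R) D p b w i \<in> carrier R" using Dw by (rule vecs_S_carrier)
      have "lincomb (ring_module R) w (D i) p = lincomb (ring_module R) (D i) w p"
        using wc mat_overD[OF D i] by (rule lincomb_ring_comm)
      then show "lincomb (ring_module R) w (D i) p = mat_act (ring_module R) D p b w i"
        using i by (simp add: mat_act_lincomb)
    qed (use e in auto)
    finally show ?thesis by simp
  qed
  have fL: "f j \<in> L" if j: "j < p" for j
  proof -
    define \<delta> where "\<delta> = (\<lambda>i. if i = j then \<one>\<^bsub>R\<^esub> else \<zero>\<^bsub>R\<^esub>)"
    have \<delta>v: "\<delta> \<in> vecs (ring_module R) p" using S.delta_vecs[OF j, of "\<one>\<^bsub>R\<^esub>", unfolded ring_module_simps] by (simp add: \<delta>_def)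
    have fc: "f i \<in> carrier M" if "i < p" for i
      unfolding f_def by (rule lincomb_closed) (use that e D mat_overD in auto)
    have "lincomb M \<delta> f p = f j"
      using lincomb_delta_l[OF j, of "\<one>\<^bsub>R\<^esub>" f] fc j by (simp add: \<delta>_def)
    moreover have "lincomb M (mat_act (ring_module R) D p b \<delta>) e b \<in> L" using K \<delta>v by blast
    ultimately show ?thesis using comp[OF \<delta>v] by simp
  qed
  show ?thesis
    unfolding fin_gen_def
  proof (intro exI[of _ p] exI[of _ f] conjI ballI allI impI)
    show "f j \<in> carrier (M\<lparr>carrier := L\<rparr>)" if "j < p" for j using fL that by simp
    fix z assume "z \<in> carrier (M\<lparr>carrier := L\<rparr>)"
    then have z: "z \<in> L" by simp
    then obtain c where c: "c \<in> vecs (ring_module R) b" "z = lincomb M c e b"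
      using gen submoduleE(1)[OF L] by blast
    then have "c \<in> {c \<in> vecs (ring_module R) b. lincomb M c e b \<in> L}" using z by simp
    then obtain w where w: "w \<in> vecs (ring_module R) p" "c = mat_act (ring_module R) D p b w" unfolding K by blast
    have "z = lincomb M w f p" using comp[OF w(1)] w c by simp
    also have "\<dots> = lincomb (M\<lparr>carrier := L\<rparr>) w f p"
      by (rule lincomb_submodule[OF L, symmetric]) (use w vecs_S_carrier fL in auto)
    finally show "\<exists>c\<in>vecs (ring_module R) p. z = lincomb (M\<lparr>carrier := L\<rparr>) c f p" using w by blast
  qed
qed

lemma zero_submodule: "submodule {\<zero>\<^bsub>M\<^esub>} R M"
  by (rule submoduleI) (auto simp: M.add.inv_one)

text \<open>Each kernel is covered by a further matrix, and dependent choice strings these matrices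
  together.\<close>

lemma ex_free_resolution:
  assumes N: "noetherian_ring R" and fg: "fin_gen R M"
  shows "\<exists>b d e. free_resolution R M b d e"
proof -
  interpret N: noetherian_cring R using N R.is_cring by (simp add: noetherian_cring_def)
  obtain b0 e where e: "\<forall>j<b0. e j \<in> carrier M"
    and gen: "\<forall>z\<in>carrier M. \<exists>c\<in>vecs (ring_module R) b0. z = lincomb M c e b0"
    using fg unfolding fin_gen_def by blast
  obtain b1 D1 where D1: "mat_over R D1 b1 b0"
    and K1: "{c \<in> vecs (ring_module R) b0. lincomb M c e b0 \<in> {\<zero>\<^bsub>M\<^esub>}} = mat_act (ring_module R) D1 b1 b0 ` vecs (ring_module R) b1"
    using N.vec_submodule_mat[OF kernel_vec_submodule[OF e zero_submodule]] by blast
  \<comment> \<open>A state (q, p, D) is a map R^p to R^q; \<open>P\<close> pins the first state to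
    the presentation of \<open>M\<close>, and \<open>Q\<close> says that the next map covers the
    kernel of the present one.\<close>
  define P where "P = (\<lambda>(n::nat) (q, p, D). (n = 0 \<longrightarrow> q = b0 \<and> p = b1 \<and> D = D1) \<and> mat_over R D p q)"
  define Q where "Q = (\<lambda>(n::nat) (q, p, D) (q', p', D'). q' = p \<and>
    {c \<in> vecs (ring_module R) p. mat_act (ring_module R) D p q c = (\<lambda>_. \<zero>\<^bsub>R\<^esub>)}
      = mat_act (ring_module R) D' p' p ` vecs (ring_module R) p')"
  have "\<exists>f. \<forall>n. P n (f n) \<and> Q n (f n) (f (Suc n))"
  proof (rule dependent_nat_choice)
    show "\<exists>t. P 0 t" using D1 by (auto simp: P_def)
    fix t n assume "P n t"
    then obtain q p D where t: "t = (q, p, D)" and D: "mat_over R D p q" by (auto simp: P_def split: prod.splits)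
    have "vec_submodule R p {c \<in> vecs (ring_module R) p. mat_act (ring_module R) D p q c = (\<lambda>_. \<zero>\<^bsub>R\<^esub>)}"
      unfolding vec_submodule_def
      using S.zero_vecs[of p] S.mat_act_zero[OF D] S.add_vecs[of _ p] S.mat_act_add[OF D] S.smult_vecs[of _ _ p] S.mat_act_smult[OF D]
      by auto
    then obtain p' D' where "mat_over R D' p' p"
      "{c \<in> vecs (ring_module R) p. mat_act (ring_module R) D p q c = (\<lambda>_. \<zero>\<^bsub>R\<^esub>)}
      = mat_act (ring_module R) D' p' p ` vecs (ring_module R) p'"
      using N.vec_submodule_mat by blast
    then have "P (Suc n) (p, p', D') \<and> Q n t (p, p', D')" by (simp add: P_def Q_def t)
    then show "\<exists>t'. P (Suc n) t' \<and> Q n t t'" by blast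
  qed
  then obtain f where f: "\<And>n. P n (f n)" "\<And>n. Q n (f n) (f (Suc n))" by blast
  define b where "b i = fst (f i)" for i
  \<comment> \<open>\<open>f i\<close> holds the differential from degree i + 1 to degree i, hence
    the shift; \<open>d 0\<close> is a dummy value.\<close>
  define d where "d i = snd (snd (f (i - 1)))" for i
  have b_Suc: "b (Suc i) = fst (snd (f i))" for i
    using f(2)[of i] by (auto simp: Q_def b_def split: prod.splits)
  have f_eq: "f i = (b i, b (Suc i), d (Suc i))" for i
    unfolding b_Suc by (simp add: b_def d_def)
  have f0: "b 0 = b0" "b 1 = b1" "d 1 = D1" using f(1)[of 0] f_eq[of 0] by (auto simp: P_def)
  have dm: "mat_over R (d (Suc i)) (b (Suc i)) (b i)" for i using f(1)[of i] f_eq[of i] by (auto simp: P_def)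
  have ex: "{c \<in> vecs (ring_module R) (b (Suc i)). mat_act (ring_module R) (d (Suc i)) (b (Suc i)) (b i) c = (\<lambda>_. \<zero>\<^bsub>R\<^esub>)}
      = mat_act (ring_module R) (d (Suc (Suc i))) (b (Suc (Suc i))) (b (Suc i)) ` vecs (ring_module R) (b (Suc (Suc i)))" for i
    using f(2)[of i] f_eq[of i] f_eq[of "Suc i"] by (simp add: Q_def)
  have "free_resolution R M b d e"
    unfolding free_resolution_def
  proof (intro conjI allI impI ballI)
    show "d i k j \<in> carrier R" if "1 \<le> i" "k < b (i - 1)" "j < b i" for i k j
      using dm[of "i - 1"] that by (auto intro: mat_overD)
    show "e j \<in> carrier M" if "j < b 0" for j using e that f0 by simp
    show "\<exists>c\<in>vecs (ring_module R) (b 0). z = lincomb M c e (b 0)" if "z \<in> carrier M" for z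
      using gen that f0 by simp
    show "lincomb M c e (b 0) = \<zero>\<^bsub>M\<^esub> \<longleftrightarrow>
      (\<exists>w\<in>vecs (ring_module R) (b 1). c = mat_act (ring_module R) (d 1) (b 1) (b 0) w)"
      if "c \<in> vecs (ring_module R) (b 0)" for c
      using K1 that unfolding f0 by blast
    show "mat_act (ring_module R) (d i) (b i) (b (i - 1)) c = (\<lambda>_. \<zero>\<^bsub>R\<^esub>) \<longleftrightarrow>
      (\<exists>w\<in>vecs (ring_module R) (b (Suc i)). c = mat_act (ring_module R) (d (Suc i)) (b (Suc i)) (b i) w)"
      if i: "1 \<le> i" and c: "c \<in> vecs (ring_module R) (b i)" for i c
    proof -
      obtain i' where "i = Suc i'" using i by (cases i) auto
      then show ?thesis using ex[of i'] c by auto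
    qed
  qed
  then show ?thesis by blast
qed

end

section \<open>Balancing Tor\<close>

context basic_module
begin

lemma resolution_mat: "free_resolution R M b d e \<Longrightarrow> mat_over R (d (Suc i)) (b (Suc i)) (b i)"
  unfolding free_resolution_def mat_over_def by (metis diff_Suc_1 le_add1 plus_1_eq_Suc)

lemma resolution_aug: "free_resolution R M b d e \<Longrightarrow> j < b 0 \<Longrightarrow> e j \<in> carrier M"
  unfolding free_resolution_def by blast

lemma resolution_surj:
  "free_resolution R M b d e \<Longrightarrow> y \<in> carrier M \<Longrightarrow> \<exists>c\<in>vecs (ring_module R) (b 0). y = lincomb M c e (b 0)"
  unfolding free_resolution_def by blast

lemma resolution_exact_aug:
  "free_resolution R M b d e \<Longrightarrow> c \<in> vecs (ring_module R) (b 0) \<Longrightarrow>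
    lincomb M c e (b 0) = \<zero>\<^bsub>M\<^esub> \<longleftrightarrow>
    (\<exists>w\<in>vecs (ring_module R) (b 1). c = mat_act (ring_module R) (d 1) (b 1) (b 0) w)"
  unfolding free_resolution_def by blast

lemma resolution_exact:
  assumes "free_resolution R M b d e" "c \<in> vecs (ring_module R) (b (Suc i))"
  shows "mat_act (ring_module R) (d (Suc i)) (b (Suc i)) (b i) c = (\<lambda>_. \<zero>\<^bsub>R\<^esub>) \<longleftrightarrow>
    (\<exists>w\<in>vecs (ring_module R) (b (Suc (Suc i))).
      c = mat_act (ring_module R) (d (Suc (Suc i))) (b (Suc (Suc i))) (b (Suc i)) w)"
proof -
  have "\<forall>i\<ge>1. \<forall>c\<in>vecs (ring_module R) (b i).
        mat_act (ring_module R) (d i) (b i) (b (i - 1)) c = (\<lambda>_. \<zero>\<^bsub>R\<^esub>) \<longleftrightarrow>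
        (\<exists>w\<in>vecs (ring_module R) (b (Suc i)).
            c = mat_act (ring_module R) (d (Suc i)) (b (Suc i)) (b i) w)"
    using assms(1) unfolding free_resolution_def by blast
  from this[rule_format, of "Suc i" c] assms(2) show ?thesis by simp
qed

end

text \<open>Elements of $R^b \otimes R^c$ are $b \times c$ matrices, extended by zero.\<close>
definition tensors :: "'a ring \<Rightarrow> nat \<Rightarrow> nat \<Rightarrow> (nat \<Rightarrow> nat \<Rightarrow> 'a) set" where
  "tensors R b c = {z. (\<forall>i<b. \<forall>j<c. z i j \<in> carrier R) \<and> (\<forall>i j. \<not> (i < b \<and> j < c) \<longrightarrow> z i j = \<zero>\<^bsub>R\<^esub>)}"

definition transp :: "(nat \<Rightarrow> nat \<Rightarrow> 'a) \<Rightarrow> nat \<Rightarrow> nat \<Rightarrow> 'a" where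
  "transp z = (\<lambda>j i. z i j)"

text \<open>The map id \<otimes> D: the second tensor factor runs along the rows.\<close>

definition rowact :: "'a ring \<Rightarrow> (nat \<Rightarrow> nat \<Rightarrow> 'a) \<Rightarrow> nat \<Rightarrow> nat \<Rightarrow> (nat \<Rightarrow> nat \<Rightarrow> 'a) \<Rightarrow> nat \<Rightarrow> nat \<Rightarrow> 'a" where
  "rowact R D p q z = (\<lambda>i. mat_act (ring_module R) D p q (z i))"

text \<open>The map D \<otimes> id. Conjugating by transposition lets its lemmas be read off from
  those on rows.\<close>

definition colact :: "'a ring \<Rightarrow> (nat \<Rightarrow> nat \<Rightarrow> 'a) \<Rightarrow> nat \<Rightarrow> nat \<Rightarrow> (nat \<Rightarrow> nat \<Rightarrow> 'a) \<Rightarrow> nat \<Rightarrow> nat \<Rightarrow> 'a" where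
  "colact R D p q z = transp (rowact R D p q (transp z))"

text \<open>The identity tensored with the augmentation, a map from R^p \<otimes> R^b to R^p
  \<otimes> M = M^p.\<close>

definition augr :: "('a, 'm) module \<Rightarrow> (nat \<Rightarrow> 'm) \<Rightarrow> nat \<Rightarrow> (nat \<Rightarrow> nat \<Rightarrow> 'a) \<Rightarrow> nat \<Rightarrow> 'm" where
  "augr M e b z = (\<lambda>i. lincomb M (z i) e b)"

definition tplus :: "'a ring \<Rightarrow> (nat \<Rightarrow> nat \<Rightarrow> 'a) \<Rightarrow> (nat \<Rightarrow> nat \<Rightarrow> 'a) \<Rightarrow> nat \<Rightarrow> nat \<Rightarrow> 'a" where
  "tplus R z y = (\<lambda>i j. z i j \<oplus>\<^bsub>R\<^esub> y i j)"

definition tminus :: "'a ring \<Rightarrow> (nat \<Rightarrow> nat \<Rightarrow> 'a) \<Rightarrow> (nat \<Rightarrow> nat \<Rightarrow> 'a) \<Rightarrow> nat \<Rightarrow> nat \<Rightarrow> 'a" where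
  "tminus R z y = (\<lambda>i j. z i j \<ominus>\<^bsub>R\<^esub> y i j)"

definition tzero :: "'a ring \<Rightarrow> nat \<Rightarrow> nat \<Rightarrow> 'a" where
  "tzero R = (\<lambda>_ _. \<zero>\<^bsub>R\<^esub>)"

lemma transp_tr [simp]: "transp (transp z) = z"
  by (simp add: transp_def)

lemma transp_tensors [simp]: "transp z \<in> tensors R c b \<longleftrightarrow> z \<in> tensors R b c"
  by (auto simp: transp_def tensors_def)

lemma transp_ops [simp]: "transp (tplus R z y) = tplus R (transp z) (transp y)" "transp (tminus R z y) = tminus R (transp z) (transp y)"
    "transp (tzero R) = tzero R"
  by (simp_all add: transp_def tplus_def tminus_def tzero_def)

lemma transp_eq_iff: "transp y = z \<longleftrightarrow> y = transp z"
  by (auto simp: transp_def)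

section \<open>Row and column maps and augmentations on tensors\<close>

context basic_module
begin

lemma tensors_iff: "z \<in> tensors R b c \<longleftrightarrow> (\<forall>i. z i \<in> vecs (ring_module R) c) \<and> (\<forall>i\<ge>b. z i = (\<lambda>_. \<zero>\<^bsub>R\<^esub>))"
  (is "?L \<longleftrightarrow> ?Q")
proof
  assume ?L
  then show ?Q unfolding tensors_def vecs_def by (auto simp: fun_eq_iff) (metis R.zero_closed not_less)
next
  assume ?Q
  then show ?L unfolding tensors_def vecs_def by auto
qed

lemma tensorsD: "z \<in> tensors R b c \<Longrightarrow> z i \<in> vecs (ring_module R) c"
  by (simp add: tensors_iff)

lemma tensors_carrier: "z \<in> tensors R b c \<Longrightarrow> z i j \<in> carrier R"
  using tensorsD vecs_S_carrier by blast

lemma tminus_tens: "z \<in> tensors R b c \<Longrightarrow> y \<in> tensors R b c \<Longrightarrow> tminus R z y \<in> tensors R b c"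
  using S.minus_self[of "\<zero>\<^bsub>R\<^esub>"] by (auto simp: tensors_def tminus_def)

lemma rowact_tens:
  assumes D: "mat_over R D p q" and z: "z \<in> tensors R b p"
  shows "rowact R D p q z \<in> tensors R b q"
  using S.mat_act_closed[OF D tensorsD[OF z]] z S.mat_act_zero[OF D] by (auto simp: tensors_iff rowact_def)

lemma colact_tens:
  "mat_over R D p q \<Longrightarrow> z \<in> tensors R p c \<Longrightarrow> colact R D p q z \<in> tensors R q c"
  by (simp add: colact_def rowact_tens)

lemma rowact_add:
  "mat_over R D p q \<Longrightarrow> z \<in> tensors R b p \<Longrightarrow> y \<in> tensors R b p \<Longrightarrow>
    rowact R D p q (tplus R z y) = tplus R (rowact R D p q z) (rowact R D p q y)"
  unfolding rowact_def tplus_def using S.mat_act_add[OF _ tensorsD tensorsD] by simp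

lemma rowact_minus:
  "mat_over R D p q \<Longrightarrow> z \<in> tensors R b p \<Longrightarrow> y \<in> tensors R b p \<Longrightarrow>
    rowact R D p q (tminus R z y) = tminus R (rowact R D p q z) (rowact R D p q y)"
  unfolding rowact_def tminus_def using S.mat_act_minus[OF _ tensorsD tensorsD] by simp

lemma colact_add:
  "mat_over R D p q \<Longrightarrow> z \<in> tensors R p c \<Longrightarrow> y \<in> tensors R p c \<Longrightarrow>
    colact R D p q (tplus R z y) = tplus R (colact R D p q z) (colact R D p q y)"
  by (simp add: colact_def rowact_add[where b = c])

lemma tminus_eq_zero_iff:
  assumes "z \<in> tensors R b c" "y \<in> tensors R b c"
  shows "tminus R z y = tzero R \<longleftrightarrow> z = y"
proof -
  have "z i j \<ominus>\<^bsub>R\<^esub> y i j = \<zero>\<^bsub>R\<^esub> \<longleftrightarrow> z i j = y i j" for i j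
    using tensors_carrier[OF assms(1)] tensors_carrier[OF assms(2)] R.r_right_minus_eq by simp
  then show ?thesis by (simp add: tminus_def tzero_def fun_eq_iff)
qed

lemma tminus_eq_imp:
  assumes "z \<in> tensors R b c" "y \<in> tensors R b c" "tminus R z y = w"
  shows "z = tplus R y w"
proof -
  have "z i j = y i j \<oplus>\<^bsub>R\<^esub> (z i j \<ominus>\<^bsub>R\<^esub> y i j)" for i j
    using tensors_carrier[OF assms(1), of i j] tensors_carrier[OF assms(2), of i j]
    by (simp add: a_minus_def R.a_comm[of "z i j"] R.r_neg2)
  then show ?thesis unfolding assms(3)[symmetric] by (simp add: tminus_def tplus_def fun_eq_iff)
qed

text \<open>Tensoring with a free module keeps exactness, because the condition splits into one for
  each row.\<close>

lemma rowact_exact: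
  assumes D': "mat_over R D' r p"
    and ex: "\<And>c. c \<in> vecs (ring_module R) p \<Longrightarrow> mat_act (ring_module R) D p q c = (\<lambda>_. \<zero>\<^bsub>R\<^esub>) \<Longrightarrow>
      \<exists>w\<in>vecs (ring_module R) r. c = mat_act (ring_module R) D' r p w"
    and z: "z \<in> tensors R b p" and 0: "rowact R D p q z = tzero R"
  shows "\<exists>y\<in>tensors R b r. z = rowact R D' r p y"
proof -
  have "\<forall>i. \<exists>w\<in>vecs (ring_module R) r. z i = mat_act (ring_module R) D' r p w"
    using ex[OF tensorsD[OF z]] fun_cong[OF 0] by (simp add: rowact_def tzero_def)
  then obtain y where y: "\<And>i. y i \<in> vecs (ring_module R) r" "\<And>i. z i = mat_act (ring_module R) D' r p (y i)"
    by metis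
  \<comment> \<open>The chosen preimages are reset to zero from row \<open>b\<close> on, as
    membership in \<open>tensors\<close> requires.\<close>
  define y' where "y' i = (if i < b then y i else (\<lambda>_. \<zero>\<^bsub>R\<^esub>))" for i
  have "y' \<in> tensors R b r" using y(1) S.zero_vecs[of r] by (simp add: tensors_iff y'_def)
  moreover have "z = rowact R D' r p y'"
  proof
    fix i show "z i = rowact R D' r p y' i"
      using y(2)[of i] z S.mat_act_zero[OF D'] by (auto simp: rowact_def y'_def tensors_iff)
  qed
  ultimately show ?thesis by blast
qed

lemma row_col_commute:
  assumes D: "mat_over R D p q" and D': "mat_over R D' p' q'" and z: "z \<in> tensors R p p'"
  shows "colact R D p q (rowact R D' p' q' z) = rowact R D' p' q' (colact R D p q z)"
proof (intro ext)
  fix i j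
  note zc = tensors_carrier[OF z]
  have 1: "colact R D p q (rowact R D' p' q' z) i j
      = mat_act (ring_module R) D p q (\<lambda>i'. mat_act (ring_module R) D' p' q' (z i') j) i"
    by (simp add: colact_def rowact_def transp_def)
  have 2: "rowact R D' p' q' (colact R D p q z) i j
      = mat_act (ring_module R) D' p' q' (\<lambda>j'. mat_act (ring_module R) D p q (\<lambda>i'. z i' j') i) j"
    by (simp add: colact_def rowact_def transp_def)
  show "colact R D p q (rowact R D' p' q' z) i j = rowact R D' p' q' (colact R D p q z) i j"
  proof (cases "i < q \<and> j < q'")
    case True
    have "lincomb (ring_module R) (D i) (\<lambda>i'. lincomb (ring_module R) (D' j) (z i') p') p
        = lincomb (ring_module R) (D' j) (\<lambda>j'. lincomb (ring_module R) (D i) (\<lambda>i'. z i' j') p) p'"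
      using S.lincomb_swap[where a = "D i" and c = "D' j" and p = p and b = p' and x = "\<lambda>i j. z j i"]
        mat_overD[OF D] mat_overD[OF D'] True zc by simp
    with True show ?thesis unfolding 1 2 by (simp add: mat_act_lincomb)
  next
    case False
    then show ?thesis unfolding 1 2
      using fun_cong[OF S.mat_act_zero[OF D], of i] fun_cong[OF S.mat_act_zero[OF D'], of j]
      by (auto simp: mat_act_lincomb)
  qed
qed

lemma augr_vecs:
  assumes e: "\<And>j. j < c \<Longrightarrow> e j \<in> carrier M" and z: "z \<in> tensors R b c"
  shows "augr M e c z \<in> vecs M b"
proof (rule vecsI)
  show "augr M e c z j \<in> carrier M" for j
    unfolding augr_def using e tensors_carrier[OF z] by simp
  show "augr M e c z j = \<zero>\<^bsub>M\<^esub>" if "b \<le> j" for j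
    using z that e by (auto simp: augr_def tensors_iff intro!: lincomb_zero_l)
qed

lemma augr_add:
  assumes e: "\<And>j. j < c \<Longrightarrow> e j \<in> carrier M" and z: "z \<in> tensors R b c" and y: "y \<in> tensors R b c"
  shows "augr M e c (tplus R z y) = (\<lambda>i. augr M e c z i \<oplus>\<^bsub>M\<^esub> augr M e c y i)"
  unfolding augr_def tplus_def
  by (rule ext, rule lincomb_add_l) (use e tensors_carrier[OF z] tensors_carrier[OF y] in auto)

lemma augr_minus:
  assumes e: "\<And>j. j < c \<Longrightarrow> e j \<in> carrier M" and z: "z \<in> tensors R b c" and y: "y \<in> tensors R b c"
  shows "augr M e c (tminus R z y) = (\<lambda>i. augr M e c z i \<ominus>\<^bsub>M\<^esub> augr M e c y i)"
  unfolding augr_def tminus_def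
  by (rule ext, rule lincomb_minus_l) (use e tensors_carrier[OF z] tensors_carrier[OF y] in auto)

text \<open>Naturality of the augmentation: it carries the differential of the other resolution to
  the one with coefficients in \<open>M\<close>.\<close>

lemma augr_colact:
  assumes e: "\<And>j. j < c \<Longrightarrow> e j \<in> carrier M" and D: "mat_over R D p q" and z: "z \<in> tensors R p c"
  shows "augr M e c (colact R D p q z) = mat_act M D p q (augr M e c z)"
proof
  fix i
  show "augr M e c (colact R D p q z) i = mat_act M D p q (augr M e c z) i"
  proof (cases "i < q")
    case True
    have "lincomb M (D i) (\<lambda>i'. lincomb M (z i') e c) p
        = lincomb M (\<lambda>j. lincomb (ring_module R) (D i) (\<lambda>i'. z i' j) p) e c"
      using lincomb_lincomb[where a = "D i" and p = p and b = c and e = e and z = "\<lambda>i j. z j i"]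
        mat_overD[OF D] True e tensors_carrier[OF z] by simp
    with True show ?thesis by (simp add: augr_def colact_def rowact_def transp_def mat_act_lincomb)
  next
    case False
    have "lincomb M (\<lambda>j. \<zero>\<^bsub>R\<^esub>) e c = \<zero>\<^bsub>M\<^esub>" by (rule lincomb_zero_l) (use e in auto)
    with False show ?thesis by (simp add: augr_def colact_def rowact_def transp_def mat_act_lincomb)
  qed
qed

lemma augr_surj:
  assumes F: "free_resolution R M b d e" and v: "v \<in> vecs M p"
  shows "\<exists>z\<in>tensors R p (b 0). v = augr M e (b 0) z"
proof -
  have "\<forall>i. \<exists>c\<in>vecs (ring_module R) (b 0). v i = lincomb M c e (b 0)"
    using resolution_surj[OF F vecs_carrier[OF v]] by blast
  then obtain z where z: "\<And>i. z i \<in> vecs (ring_module R) (b 0)" "\<And>i. v i = lincomb M (z i) e (b 0)"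
    by metis
  define z' where "z' i = (if i < p then z i else (\<lambda>_. \<zero>\<^bsub>R\<^esub>))" for i
  have "z' \<in> tensors R p (b 0)" using z(1) S.zero_vecs[of "b 0"] by (simp add: tensors_iff z'_def)
  moreover have "v = augr M e (b 0) z'"
  proof
    fix i
    have "lincomb M (\<lambda>_. \<zero>\<^bsub>R\<^esub>) e (b 0) = \<zero>\<^bsub>M\<^esub>"
      by (rule lincomb_zero_l) (use resolution_aug[OF F] in auto)
    then show "v i = augr M e (b 0) z' i"
      using z(2)[of i] vecs_zero[OF v, of i] by (auto simp: augr_def z'_def)
  qed
  ultimately show ?thesis by blast
qed

lemma augr_exact:
  assumes F: "free_resolution R M b d e" and z: "z \<in> tensors R p (b 0)" and 0: "augr M e (b 0) z = (\<lambda>_. \<zero>\<^bsub>M\<^esub>)"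
  shows "\<exists>y\<in>tensors R p (b 1). z = rowact R (d 1) (b 1) (b 0) y"
proof -
  have "\<forall>i. \<exists>w\<in>vecs (ring_module R) (b 1). z i = mat_act (ring_module R) (d 1) (b 1) (b 0) w"
    using resolution_exact_aug[OF F tensorsD[OF z]] fun_cong[OF 0] by (simp add: augr_def)
  then obtain y where y: "\<And>i. y i \<in> vecs (ring_module R) (b 1)" "\<And>i. z i = mat_act (ring_module R) (d 1) (b 1) (b 0) (y i)"
    by metis
  define y' where "y' i = (if i < p then y i else (\<lambda>_. \<zero>\<^bsub>R\<^esub>))" for i
  have "y' \<in> tensors R p (b 1)" using y(1) S.zero_vecs[of "b 1"] by (simp add: tensors_iff y'_def)
  moreover have "z = rowact R (d 1) (b 1) (b 0) y'"
  proof
    fix i show "z i = rowact R (d 1) (b 1) (b 0) y' i"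
      using y(2)[of i] z S.mat_act_zero resolution_mat[OF F, of 0] by (auto simp: rowact_def y'_def tensors_iff)
  qed
  ultimately show ?thesis by blast
qed

lemma augr_rowact:
  assumes F: "free_resolution R M b d e" and y: "y \<in> tensors R p (b 1)"
  shows "augr M e (b 0) (rowact R (d 1) (b 1) (b 0) y) = (\<lambda>_. \<zero>\<^bsub>M\<^esub>)"
proof
  fix i
  have D: "mat_over R (d 1) (b 1) (b 0)" using resolution_mat[OF F, of 0] by simp
  have "mat_act (ring_module R) (d 1) (b 1) (b 0) (y i) \<in> vecs (ring_module R) (b 0)"
    using S.mat_act_closed[OF D tensorsD[OF y]] .
  from resolution_exact_aug[OF F this] tensorsD[OF y]
  show "augr M e (b 0) (rowact R (d 1) (b 1) (b 0) y) i = \<zero>\<^bsub>M\<^esub>" by (auto simp: augr_def rowact_def)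
qed

lemma rowact_resolution_exact:
  assumes F: "free_resolution R M b d e" and z: "z \<in> tensors R p (b (Suc i))"
    and 0: "rowact R (d (Suc i)) (b (Suc i)) (b i) z = tzero R"
  shows "\<exists>y\<in>tensors R p (b (Suc (Suc i))). z = rowact R (d (Suc (Suc i))) (b (Suc (Suc i))) (b (Suc i)) y"
  by (rule rowact_exact[OF resolution_mat[OF F] _ z 0]) (use resolution_exact[OF F] in blast)

lemma rowact_resolution_complex:
  assumes F: "free_resolution R M b d e" and y: "y \<in> tensors R p (b (Suc (Suc i)))"
  shows "rowact R (d (Suc i)) (b (Suc i)) (b i)
    (rowact R (d (Suc (Suc i))) (b (Suc (Suc i))) (b (Suc i)) y) = tzero R"
proof
  fix k
  have "mat_act (ring_module R) (d (Suc (Suc i))) (b (Suc (Suc i))) (b (Suc i)) (y k) \<in> vecs (ring_module R) (b (Suc i))"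
    using S.mat_act_closed[OF resolution_mat[OF F] tensorsD[OF y]] .
  from resolution_exact[OF F this] tensorsD[OF y]
  show "rowact R (d (Suc i)) (b (Suc i)) (b i)
    (rowact R (d (Suc (Suc i))) (b (Suc (Suc i))) (b (Suc i)) y) k = tzero R k"
    by (auto simp: rowact_def tzero_def)
qed

end

section \<open>The double complex of two resolutions\<close>

locale two_resolutions = A: basic_module R A + B: basic_module R B
  for R :: "'a ring" and A :: "('a, 'm) module" and B :: "('a, 'n) module" +
  fixes b d e c d' e'
  assumes FA: "free_resolution R A b d e" and FB: "free_resolution R B c d' e'"
begin

text \<open>F is the resolution of \<open>A\<close> with ranks \<open>b\<close>, P that of
  \<open>B\<close> with ranks \<open>c\<close>, and F_i \<otimes> P_j is
  \<open>tensors R (b i) (c j)\<close>. The index of a differential is the degree of its target. No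
  signs are introduced, so the squares commute.\<close>

abbreviation "dF i \<equiv> colact R (d (Suc i)) (b (Suc i)) (b i)"
abbreviation "dP j \<equiv> rowact R (d' (Suc j)) (c (Suc j)) (c j)"

lemma dF_tens: "z \<in> tensors R (b (Suc i)) k \<Longrightarrow> dF i z \<in> tensors R (b i) k"
  by (rule A.colact_tens[OF A.resolution_mat[OF FA]])

lemma dP_tens: "z \<in> tensors R k (c (Suc j)) \<Longrightarrow> dP j z \<in> tensors R k (c j)"
  by (rule A.rowact_tens[OF B.resolution_mat[OF FB]])

lemma commute: "z \<in> tensors R (b (Suc i)) (c (Suc j)) \<Longrightarrow> dF i (dP j z) = dP j (dF i z)"
  by (rule A.row_col_commute[OF A.resolution_mat[OF FA] B.resolution_mat[OF FB]])

lemma dF_exact: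
  assumes "z \<in> tensors R (b (Suc i)) k" "dF i z = tzero R"
  shows "\<exists>y\<in>tensors R (b (Suc (Suc i))) k. z = dF (Suc i) y"
proof -
  have "rowact R (d (Suc i)) (b (Suc i)) (b i) (transp z) = tzero R"
    using assms(2) unfolding colact_def by (simp add: transp_eq_iff)
  from A.rowact_resolution_exact[OF FA _ this, of k] assms(1)
  obtain y where y: "y \<in> tensors R k (b (Suc (Suc i)))"
    "transp z = rowact R (d (Suc (Suc i))) (b (Suc (Suc i))) (b (Suc i)) y" by auto
  then have "z = dF (Suc i) (transp y)" unfolding colact_def by (metis transp_tr)
  then show ?thesis using y(1) by (intro bexI[of _ "transp y"]) auto
qed

lemma dF_dF: "z \<in> tensors R (b (Suc (Suc i))) k \<Longrightarrow> dF i (dF (Suc i) z) = tzero R"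
  using A.rowact_resolution_complex[OF FA, of "transp z" k i] by (simp add: colact_def)

text \<open>\<open>H\<close> is the vanishing of the homology of F \<otimes> B in degree n + 1. The
  chase walks along the diagonal i + j = n: exactness in the F direction moves the problem for
  \<open>z'\<close> one step towards j = 0, where \<open>z'\<close> can be augmented and
  \<open>H\<close> applies; the decomposition of \<open>z'\<close> so obtained then yields that of
  \<open>z\<close>.\<close>

lemma chase:
  assumes H: "\<And>u. u \<in> vecs B (b (Suc n)) \<Longrightarrow>
      mat_act B (d (Suc n)) (b (Suc n)) (b n) u = (\<lambda>_. \<zero>\<^bsub>B\<^esub>) \<Longrightarrow>
      \<exists>w\<in>vecs B (b (Suc (Suc n))). u = mat_act B (d (Suc (Suc n))) (b (Suc (Suc n))) (b (Suc n)) w"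
    and "i + j = n" "z \<in> tensors R (b i) (c (Suc j))" "z' \<in> tensors R (b (Suc i)) (c j)" "dP j z = dF i z'"
  shows "\<exists>y'\<in>tensors R (b (Suc i)) (c (Suc j)). \<exists>y\<in>tensors R (b i) (c (Suc (Suc j))).
    z = tplus R (dF i y') (dP (Suc j) y)"
  using assms(2-)
proof (induction j arbitrary: i z z')
  case 0
  note z = \<open>z \<in> tensors R (b i) (c (Suc 0))\<close> and z' = \<open>z' \<in> tensors R (b (Suc i)) (c 0)\<close>
  note e' = B.resolution_aug[OF FB]
  have i: "i = n" using 0 by simp
  have dFi: "mat_over R (d (Suc i)) (b (Suc i)) (b i)" "mat_over R (d (Suc (Suc i))) (b (Suc (Suc i))) (b (Suc i))" for i
    by (rule A.resolution_mat[OF FA])+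
  \<comment> \<open>The class of \<open>z'\<close> in F \<otimes> B is a cycle because
    \<open>dF i z'\<close> = \<open>dP 0 z\<close> is killed by the augmentation.\<close>
  define u where "u = augr B e' (c 0) z'"
  have u: "u \<in> vecs B (b (Suc n))" unfolding u_def using B.augr_vecs[OF e' z'] i by simp
  have "mat_act B (d (Suc i)) (b (Suc i)) (b i) u = augr B e' (c 0) (dF i z')"
    unfolding u_def by (rule B.augr_colact[OF e' dFi(1) z', symmetric])
  also have "\<dots> = (\<lambda>_. \<zero>\<^bsub>B\<^esub>)"
    using B.augr_rowact[OF FB, of z "b i"] z 0(4) by simp
  finally obtain w where w: "w \<in> vecs B (b (Suc (Suc i)))"
    "u = mat_act B (d (Suc (Suc i))) (b (Suc (Suc i))) (b (Suc i)) w"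
    using H[OF u] i by auto
  obtain v where v: "v \<in> tensors R (b (Suc (Suc i))) (c 0)" "w = augr B e' (c 0) v"
    using B.augr_surj[OF FB w(1)] by blast
  have dv: "dF (Suc i) v \<in> tensors R (b (Suc i)) (c 0)" using v(1) by (rule dF_tens)
  have "augr B e' (c 0) (tminus R z' (dF (Suc i) v)) = (\<lambda>k. u k \<ominus>\<^bsub>B\<^esub> u k)"
    using B.augr_minus[OF e' z' dv] B.augr_colact[OF e' dFi(2) v(1)] w v by (simp add: u_def)
  also have "\<dots> = (\<lambda>_. \<zero>\<^bsub>B\<^esub>)" using B.minus_self[OF B.vecs_carrier[OF u]] by simp
  finally obtain y' where y': "y' \<in> tensors R (b (Suc i)) (c 1)" "tminus R z' (dF (Suc i) v) = rowact R (d' 1) (c 1) (c 0) y'"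
    using B.augr_exact[OF FB A.tminus_tens[OF z' dv]] by blast
  have z'_eq: "z' = tplus R (dF (Suc i) v) (dP 0 y')"
    using A.tminus_eq_imp[OF z' dv y'(2)] by simp
  have y'1: "y' \<in> tensors R (b (Suc i)) (c (Suc 0))" using y'(1) by simp
  have "dP 0 z = dF i (tplus R (dF (Suc i) v) (dP 0 y'))" using 0(4) z'_eq by simp
  also have "\<dots> = tplus R (dF i (dF (Suc i) v)) (dF i (dP 0 y'))"
    by (rule A.colact_add[OF dFi(1) dv dP_tens[OF y'1]])
  also have "\<dots> = tplus R (tzero R) (dP 0 (dF i y'))" using dF_dF[OF v(1)] commute[OF y'1] by simp
  also have "\<dots> = dP 0 (dF i y')"
    using A.tensors_carrier[OF dP_tens[OF dF_tens[OF y'1]]] by (simp add: tplus_def tzero_def)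
  finally have eq: "dP 0 z = dP 0 (dF i y')" .
  \<comment> \<open>In z' = dF v + dP y' the first summand dies under \<open>dF\<close>, so
    \<open>z\<close> and \<open>dF i y'\<close> have the same image under \<open>dP\<close>; their
    difference is a boundary as P is exact in positive degrees.\<close>
  have "dP 0 (tminus R z (dF i y')) = tzero R"
    using A.rowact_minus[OF B.resolution_mat[OF FB] z dF_tens[OF y'1]] eq
      A.tminus_eq_zero_iff[OF dP_tens[OF z] dP_tens[OF dF_tens[OF y'1]]] by simp
  then obtain y where y: "y \<in> tensors R (b i) (c (Suc (Suc 0)))" "tminus R z (dF i y') = dP (Suc 0) y"
    using B.rowact_resolution_exact[OF FB A.tminus_tens[OF z dF_tens[OF y'1]]] by blast
  have "z = tplus R (dF i y') (dP (Suc 0) y)"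
    by (rule A.tminus_eq_imp[OF z dF_tens[OF y'1] y(2)])
  then show ?case using y'1 y(1) by blast
next
  case (Suc j)
  note z = \<open>z \<in> tensors R (b i) (c (Suc (Suc j)))\<close> and z' = \<open>z' \<in> tensors R (b (Suc i)) (c (Suc j))\<close>
  \<comment> \<open>This makes \<open>dP j z'\<close> a cycle for \<open>dF\<close>, hence a
    boundary \<open>dF (Suc i) z''\<close>; the pair of \<open>z'\<close> and \<open>z''\<close> is
    the same problem one place further along the diagonal.\<close>
  have "dF i (dP j z') = dP j (dP (Suc j) z)" using commute[OF z'] Suc.prems(4) by simp
  also have "\<dots> = tzero R" by (rule B.rowact_resolution_complex[OF FB z])
  finally obtain z'' where z'': "z'' \<in> tensors R (b (Suc (Suc i))) (c j)" "dP j z' = dF (Suc i) z''"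
    using dF_exact[OF dP_tens[OF z']] by blast
  obtain v y' where v: "v \<in> tensors R (b (Suc (Suc i))) (c (Suc j))" and y': "y' \<in> tensors R (b (Suc i)) (c (Suc (Suc j)))"
    and z'_eq: "z' = tplus R (dF (Suc i) v) (dP (Suc j) y')"
    using Suc.IH[OF _ z' z''] Suc.prems(1) by auto
  have "dP (Suc j) z = dF i (tplus R (dF (Suc i) v) (dP (Suc j) y'))" using Suc.prems(4) z'_eq by simp
  also have "\<dots> = tplus R (dF i (dF (Suc i) v)) (dF i (dP (Suc j) y'))"
    by (rule A.colact_add[OF A.resolution_mat[OF FA] dF_tens[OF v] dP_tens[OF y']])
  also have "\<dots> = tplus R (tzero R) (dP (Suc j) (dF i y'))" using dF_dF[OF v] commute[OF y'] by simp
  also have "\<dots> = dP (Suc j) (dF i y')"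
    using A.tensors_carrier[OF dP_tens[OF dF_tens[OF y']]] by (simp add: tplus_def tzero_def)
  finally have eq: "dP (Suc j) z = dP (Suc j) (dF i y')" .
  have "dP (Suc j) (tminus R z (dF i y')) = tzero R"
    using A.rowact_minus[OF B.resolution_mat[OF FB] z dF_tens[OF y']] eq
      A.tminus_eq_zero_iff[OF dP_tens[OF z] dP_tens[OF dF_tens[OF y']]] by simp
  then obtain y where y: "y \<in> tensors R (b i) (c (Suc (Suc (Suc j))))" "tminus R z (dF i y') = dP (Suc (Suc j)) y"
    using B.rowact_resolution_exact[OF FB A.tminus_tens[OF z dF_tens[OF y']]] by blast
  have "z = tplus R (dF i y') (dP (Suc (Suc j)) y)"
    by (rule A.tminus_eq_imp[OF z dF_tens[OF y'] y(2)])
  then show ?case using y' y(1) by blast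
qed

text \<open>A cycle of A \<otimes> P lifts to F_0 \<otimes> P, where its differential dies in
  \<open>A\<close> and so comes from F_1; \<open>chase\<close> with i = 0 splits the lift, and
  augmenting removes the part from F_1. Only this direction is stated, since exchanging the two
  modules gives the other.\<close>

lemma tor_balance:
  assumes H: "\<And>u. u \<in> vecs B (b (Suc n)) \<Longrightarrow>
      mat_act B (d (Suc n)) (b (Suc n)) (b n) u = (\<lambda>_. \<zero>\<^bsub>B\<^esub>) \<Longrightarrow>
      \<exists>w\<in>vecs B (b (Suc (Suc n))). u = mat_act B (d (Suc (Suc n))) (b (Suc (Suc n))) (b (Suc n)) w"
    and v: "v \<in> vecs A (c (Suc n))" and v0: "mat_act A (d' (Suc n)) (c (Suc n)) (c n) v = (\<lambda>_. \<zero>\<^bsub>A\<^esub>)"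
  shows "\<exists>w\<in>vecs A (c (Suc (Suc n))). v = mat_act A (d' (Suc (Suc n))) (c (Suc (Suc n))) (c (Suc n)) w"
proof -
  note e = A.resolution_aug[OF FA]
  note DP = B.resolution_mat[OF FB]
  \<comment> \<open>\<open>augr\<close> contracts the second index, so the lift has the factor F_0
    second; it is transposed before it enters the double complex.\<close>
  obtain z where z: "z \<in> tensors R (c (Suc n)) (b 0)" "v = augr A e (b 0) z"
    using A.augr_surj[OF FA v] by blast
  have trz: "transp z \<in> tensors R (b 0) (c (Suc n))" using z by simp
  have transp_dP: "transp (dP j y) = colact R (d' (Suc j)) (c (Suc j)) (c j) (transp y)" for j y
    by (simp add: colact_def)
  have "augr A e (b 0) (transp (dP n (transp z))) = (\<lambda>_. \<zero>\<^bsub>A\<^esub>)"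
    using A.augr_colact[OF e DP z(1)] v0 z(2) by (simp add: transp_dP)
  moreover have "transp (dP n (transp z)) \<in> tensors R (c n) (b 0)" using dP_tens[OF trz] by simp
  ultimately obtain y where y: "y \<in> tensors R (c n) (b 1)" "transp (dP n (transp z)) = rowact R (d 1) (b 1) (b 0) y"
    using A.augr_exact[OF FA] by blast
  have "dP n (transp z) = dF 0 (transp y)" using y(2) unfolding colact_def by (simp add: transp_eq_iff)
  moreover have "transp y \<in> tensors R (b (Suc 0)) (c n)" using y(1) by simp
  ultimately obtain y' y'' where y': "y' \<in> tensors R (b (Suc 0)) (c (Suc n))"
    and y'': "y'' \<in> tensors R (b 0) (c (Suc (Suc n)))" and zeq: "transp z = tplus R (dF 0 y') (dP (Suc n) y'')"
    using chase[OF H, of 0 n "transp z" "transp y"] trz by auto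
  have ty: "transp y' \<in> tensors R (c (Suc n)) (b 1)" "transp y'' \<in> tensors R (c (Suc (Suc n))) (b 0)" using y' y'' by simp_all
  have d1: "mat_over R (d 1) (b 1) (b 0)" using A.resolution_mat[OF FA, of 0] by simp
  have "z = tplus R (rowact R (d 1) (b 1) (b 0) (transp y')) (colact R (d' (Suc (Suc n))) (c (Suc (Suc n))) (c (Suc n)) (transp y''))"
    using zeq by (simp add: transp_eq_iff colact_def)
  then have "v = (\<lambda>k. augr A e (b 0) (rowact R (d 1) (b 1) (b 0) (transp y')) k
      \<oplus>\<^bsub>A\<^esub> augr A e (b 0) (colact R (d' (Suc (Suc n))) (c (Suc (Suc n))) (c (Suc n)) (transp y'')) k)"
    using A.augr_add[OF e A.rowact_tens[OF d1 ty(1)] A.colact_tens[OF DP ty(2)]] z(2) by simp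
  also have "\<dots> = mat_act A (d' (Suc (Suc n))) (c (Suc (Suc n))) (c (Suc n)) (augr A e (b 0) (transp y''))"
    using A.augr_rowact[OF FA ty(1)] A.augr_colact[OF e DP ty(2)]
      A.vecs_carrier[OF A.mat_act_closed[OF DP A.augr_vecs[OF e ty(2)]]] by simp
  finally have "v = mat_act A (d' (Suc (Suc n))) (c (Suc (Suc n))) (c (Suc n)) (augr A e (b 0) (transp y''))" .
  moreover have "augr A e (b 0) (transp y'') \<in> vecs A (c (Suc (Suc n)))" by (rule A.augr_vecs[OF e ty(2)])
  ultimately show ?thesis by blast
qed

end

section \<open>Powers of the maximal ideal\<close>

text \<open>Exactness at M^q in the sense that cycles are boundaries; that BA vanishes is supplied
  separately, from the matrices.\<close>

definition exact_pair ::
    "('a, 'm) module \<Rightarrow> (nat \<Rightarrow> nat \<Rightarrow> 'a) \<Rightarrow> nat \<Rightarrow> nat \<Rightarrow> (nat \<Rightarrow> nat \<Rightarrow> 'a) \<Rightarrow> nat \<Rightarrow> bool" where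
  "exact_pair M A p q B r \<longleftrightarrow> (\<forall>u\<in>vecs M q. mat_act M B q r u = (\<lambda>_. \<zero>\<^bsub>M\<^esub>) \<longrightarrow>
     (\<exists>w\<in>vecs M p. u = mat_act M A p q w))"

lemma mat_tact_eq_mat_act: "mat_tact M A p q = mat_act M (transp A) q p"
  by (intro ext) (simp add: mat_tact_def mat_act_def transp_def)

context basic_module
begin

text \<open>By associativity the product matrix acts, and it is zero. Asking for this on matrices
  gives the conclusion for every coefficient module at once.\<close>

lemma mat_act_comp_zero:
  assumes A: "mat_over R A p q" and B: "mat_over R B q r"
    and BA: "\<And>k i. k < r \<Longrightarrow> i < p \<Longrightarrow> lincomb (ring_module R) (B k) (\<lambda>j. A j i) q = \<zero>\<^bsub>R\<^esub>"
    and w: "w \<in> vecs M p"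
  shows "mat_act M B q r (mat_act M A p q w) = (\<lambda>_. \<zero>\<^bsub>M\<^esub>)"
proof
  fix k
  show "mat_act M B q r (mat_act M A p q w) k = \<zero>\<^bsub>M\<^esub>"
  proof (cases "k < r")
    case True
    have "lincomb M (B k) (mat_act M A p q w) q = lincomb M (B k) (\<lambda>j. lincomb M (A j) w p) q"
      by (rule lincomb_cong)
        (use mat_overD[OF B True] mat_overD[OF A] vecsD[OF w] in \<open>auto simp: mat_act_lincomb\<close>)
    also have "\<dots> = lincomb M (\<lambda>i. lincomb (ring_module R) (B k) (\<lambda>j. A j i) q) w p"
      by (rule lincomb_lincomb) (use mat_overD[OF B True] mat_overD[OF A] vecsD[OF w] in auto)
    also have "\<dots> = \<zero>\<^bsub>M\<^esub>"
      by (rule lincomb_zero_l) (use BA[OF True] vecsD[OF w] in auto)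
    finally show ?thesis using True by (simp add: mat_act_lincomb[of M B])
  qed (simp add: mat_act_lincomb)
qed

text \<open>The composite of two differentials vanishes on the standard basis vector
  \<open>\<delta>\<close>, and this gives a column of the product matrix.\<close>

lemma resolution_comp_zero:
  assumes F: "free_resolution R M b d e" and k: "k < b n" and i: "i < b (Suc (Suc n))"
  shows "lincomb (ring_module R) (d (Suc n) k) (\<lambda>j. d (Suc (Suc n)) j i) (b (Suc n)) = \<zero>\<^bsub>R\<^esub>"
proof -
  note D = resolution_mat[OF F]
  define \<delta> where "\<delta> = (\<lambda>l. if l = i then \<one>\<^bsub>R\<^esub> else \<zero>\<^bsub>R\<^esub>)"
  have \<delta>v: "\<delta> \<in> vecs (ring_module R) (b (Suc (Suc n)))"
    using S.delta_vecs[OF i, of "\<one>\<^bsub>R\<^esub>", unfolded ring_module_simps] by (simp add: \<delta>_def)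
  define c where "c = mat_act (ring_module R) (d (Suc (Suc n))) (b (Suc (Suc n))) (b (Suc n)) \<delta>"
  have c: "c \<in> vecs (ring_module R) (b (Suc n))" unfolding c_def using D \<delta>v by (rule S.mat_act_closed)
  have cj: "c j = d (Suc (Suc n)) j i" if j: "j < b (Suc n)" for j
    using S.lincomb_delta_r[OF i, of "\<one>\<^bsub>R\<^esub>" "d (Suc (Suc n)) j", unfolded ring_module_simps]
      mat_overD[OF D j] i j by (simp add: c_def mat_act_lincomb \<delta>_def)
  have "mat_act (ring_module R) (d (Suc n)) (b (Suc n)) (b n) c k = \<zero>\<^bsub>R\<^esub>"
    using resolution_exact[OF F c] \<delta>v unfolding c_def by (auto dest: fun_cong)
  then have "lincomb (ring_module R) (d (Suc n) k) c (b (Suc n)) = \<zero>\<^bsub>R\<^esub>"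
    using k by (simp add: mat_act_lincomb)
  moreover have "lincomb (ring_module R) (d (Suc n) k) (\<lambda>j. d (Suc (Suc n)) j i) (b (Suc n))
      = lincomb (ring_module R) (d (Suc n) k) c (b (Suc n))"
    by (rule S.lincomb_cong) (use mat_overD[OF D k] mat_overD[OF D _ i] cj in auto)
  ultimately show ?thesis by simp
qed

end

context regular_module
begin

text \<open>\<open>exact_descent\<close> for \<open>Z\<close> the kernel of \<open>B\<close>; the
  work lies in moving vectors and actions between \<open>M\<close> and the restricted record of
  mM.\<close>

lemma exact_pair_step:
  assumes A: "mat_over R A p q" and B: "mat_over R B q r"
    and BA: "\<And>w. w \<in> vecs M p \<Longrightarrow> mat_act M B q r (mat_act M A p q w) = (\<lambda>_. \<zero>\<^bsub>M\<^esub>)"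
    and ex: "exact_pair (M\<lparr>carrier := mM\<rparr>) A p q B r"
  shows "exact_pair M A p q B r"
  unfolding exact_pair_def
proof (intro ballI impI)
  have L: "submodule mM R M" by (rule submodule_ideal_times[OF m.is_ideal subset_refl])
  define Z where "Z = {u \<in> vecs M q. mat_act M B q r u = (\<lambda>_. \<zero>\<^bsub>M\<^esub>)}"
  fix u assume "u \<in> vecs M q" "mat_act M B q r u = (\<lambda>_. \<zero>\<^bsub>M\<^esub>)"
  then have "u \<in> Z" by (simp add: Z_def)
  then show "\<exists>w\<in>vecs M p. u = mat_act M A p q w"
  proof (rule exact_descent[OF A, rotated -1])
    show "Z \<subseteq> vecs M q" by (auto simp: Z_def)
    show "(\<lambda>i. u i \<ominus>\<^bsub>M\<^esub> v i) \<in> Z" if "u \<in> Z" "v \<in> Z" for u v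
      using that by (auto simp: Z_def minus_vecs mat_act_minus[OF B] minus_self)
    show "(\<lambda>i. a \<odot>\<^bsub>M\<^esub> u i) \<in> Z" if "a \<in> carrier R" "u \<in> Z" for a u
      using that by (auto simp: Z_def smult_vecs mat_act_smult[OF B])
    show "mat_act M A p q w \<in> Z" if "w \<in> vecs M p" for w
      using that BA mat_act_closed[OF A] by (simp add: Z_def)
    fix u assume u: "u \<in> Z" "\<And>i. i < q \<Longrightarrow> u i \<in> mM"
    then have uL: "u \<in> vecs (M\<lparr>carrier := mM\<rparr>) q" by (auto simp: Z_def vecs_def)
    have "mat_act (M\<lparr>carrier := mM\<rparr>) B q r u = (\<lambda>_. \<zero>\<^bsub>M\<lparr>carrier := mM\<rparr>\<^esub>)"
      using mat_act_submodule[OF L B uL] u(1) by (simp add: Z_def)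
    then obtain w where w: "w \<in> vecs (M\<lparr>carrier := mM\<rparr>) p" "u = mat_act (M\<lparr>carrier := mM\<rparr>) A p q w"
      using ex uL unfolding exact_pair_def by blast
    have "u = mat_act M A p q w" using w mat_act_submodule[OF L A w(1)] by simp
    moreover have "\<forall>j<p. w j \<in> mM" using w(1) by (simp add: vecs_def)
    moreover have "w \<in> vecs M p" using w(1) submoduleE(1)[OF L] by (auto simp: vecs_def)
    ultimately show "\<exists>w\<in>vecs M p. (\<forall>j<p. w j \<in> mM) \<and> u = mat_act M A p q w" by blast
  qed
qed

lemma submodule_pow: "submodule ((ideal_times M m ^^ t) (carrier M)) R M"
proof (induction t)
  case 0
  then show ?case using carrier_is_submodule by simp
next
  case (Suc t)
  then show ?case using submodule_ideal_times[OF m.is_ideal submoduleE(1)] by simp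
qed

text \<open>Regularity of \<open>x\<close> is inherited by submodules, and finite generation holds
  because the ring is Noetherian. So the descent can be repeated on each power.\<close>

lemma pow_submod_regular: "regular_module R (pow_submod M m t) m x"
proof -
  define L where "L = (ideal_times M m ^^ t) (carrier M)"
  have L: "submodule L R M" unfolding L_def by (rule submodule_pow)
  have "basic_module R (M\<lparr>carrier := L\<rparr>)"
    using submodule.submodule_is_module[OF L module_axioms] by (simp add: basic_module_def)
  moreover have "fin_gen R (M\<lparr>carrier := L\<rparr>)"
    by (rule submodule_fin_gen[OF noetherian_ring_axioms fg L])
  moreover have "y \<in> L \<Longrightarrow> x \<odot>\<^bsub>M\<^esub> y = \<zero>\<^bsub>M\<^esub> \<Longrightarrow> y = \<zero>\<^bsub>M\<^esub>" for y
    using regular submoduleE(1)[OF L] by blast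
  ultimately show ?thesis
    unfolding pow_submod_def L_def[symmetric] using local xm
    by (simp add: regular_module_def regular_module_axioms_def local_module_def local_module_axioms_def)
qed

text \<open>The product with \<open>m\<close> formed inside m^t M uses the sums of that record,
  which agree with those of \<open>M\<close>. This gives m^(t+1) M the shape that
  \<open>exact_pair_step\<close> expects over m^t M.\<close>

lemma pow_submod_Suc:
  "pow_submod M m (Suc t) =
    (pow_submod M m t)\<lparr>carrier := ideal_times (pow_submod M m t) m (carrier (pow_submod M m t))\<rparr>"
proof -
  define L where "L = (ideal_times M m ^^ t) (carrier M)"
  have L: "submodule L R M" unfolding L_def by (rule submodule_pow)
  have eq: "lincomb (M\<lparr>carrier := L\<rparr>) a y k = lincomb M a y k" if "\<forall>i<k. a i \<in> m \<and> y i \<in> L" for a y k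
    by (rule lincomb_submodule[OF L]) (use that m_carrier in auto)
  have "ideal_times (M\<lparr>carrier := L\<rparr>) m L = ideal_times M m L"
    unfolding ideal_times_def using eq by (intro Collect_cong) metis
  then show ?thesis by (simp add: pow_submod_def L_def)
qed

lemma exact_pair_pow:
  assumes A: "mat_over R A p q" and B: "mat_over R B q r"
    and BA: "\<And>k i. k < r \<Longrightarrow> i < p \<Longrightarrow> lincomb (ring_module R) (B k) (\<lambda>j. A j i) q = \<zero>\<^bsub>R\<^esub>"
    and "exact_pair (pow_submod M m t) A p q B r"
  shows "exact_pair M A p q B r"
  using assms(4)
proof (induction t)
  case 0
  then show ?case by (simp add: pow_submod_def)
next
  case (Suc t)
  interpret P: regular_module R "pow_submod M m t" m x by (rule pow_submod_regular)
  have "exact_pair (pow_submod M m t) A p q B r"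
    by (rule P.exact_pair_step[OF A B P.mat_act_comp_zero[OF A B BA]])
      (use Suc.prems in \<open>simp_all add: pow_submod_Suc\<close>)
  then show ?case by (rule Suc.IH)
qed

end

text \<open>In the case M = 0 of the depth convention, \<open>x\<close> = 0 serves.\<close>

lemma depth_regular:
  assumes "noetherian_local R m" "module R M" "fin_gen R M" "depth_ge_1 R m M"
  shows "\<exists>x. regular_module R M m x"
proof -
  interpret local_module R M m
    using assms by (simp add: local_module_def basic_module_def local_module_axioms_def)
  have "\<exists>x\<in>m. \<forall>y\<in>carrier M. x \<odot>\<^bsub>M\<^esub> y = \<zero>\<^bsub>M\<^esub> \<longrightarrow> y = \<zero>\<^bsub>M\<^esub>"
    using assms(4) unfolding depth_ge_1_def M_regular_def by (auto intro: m.zero_closed)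
  then show ?thesis
    using assms(3) local_module_axioms by (auto simp: regular_module_def regular_module_axioms_def)
qed

theorem theorem1p2:
  fixes R :: "'a ring" and m :: "'a set"
    and M :: "('a, 'm) module" and N :: "('a, 'n) module"
    and t n :: nat
  assumes "noetherian_local R m"
    and "module R M" and "fin_gen R M" and "depth_ge_1 R m M"
    and "module R N" and "fin_gen R N"
    and "n \<ge> 1"
  shows "(Tor_vanishes R n (pow_submod M m t) N \<longrightarrow> Tor_vanishes R n M N) \<and>
         (Ext_vanishes R n N (pow_submod M m t) \<longrightarrow> Ext_vanishes R n N M)"
proof -
  obtain x where "regular_module R M m x" using depth_regular[OF assms(1-4)] by blast
  then interpret M: regular_module R M m x .
  interpret P: regular_module R "pow_submod M m t" m x by (rule M.pow_submod_regular)
  interpret N: basic_module R N using assms(5) by (simp add: basic_module_def)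
  obtain n' where n: "n = Suc n'" using assms(7) by (cases n) auto
  show ?thesis
  proof (intro conjI impI)
    assume tor: "Tor_vanishes R n (pow_submod M m t) N"
    obtain c d' e' where FN: "free_resolution R N c d' e'"
      using N.ex_free_resolution[OF M.noetherian_ring_axioms assms(6)] by blast
    obtain b d e where FP: "free_resolution R (pow_submod M m t) b d e"
      using P.ex_free_resolution[OF M.noetherian_ring_axioms P.fg] by blast
    interpret PN: two_resolutions R "pow_submod M m t" N b d e c d' e'
      by unfold_locales (rule FP FN)+
    \<comment> \<open>First balancing: the hypothesis, read on the resolution of m^t M, becomes
      exactness of m^t M \<otimes> P for the resolution P of \<open>N\<close>.\<close>
    have "exact_pair (pow_submod M m t) (d' (Suc n)) (c (Suc n)) (c n) (d' n) (c n')"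
      unfolding exact_pair_def n
      by (intro ballI impI PN.tor_balance)
        (use tor FP in \<open>auto simp: Tor_vanishes_def n\<close>)
    then have "exact_pair M (d' (Suc n)) (c (Suc n)) (c n) (d' n) (c n')"
      unfolding n
      by (rule M.exact_pair_pow[OF N.resolution_mat[OF FN] N.resolution_mat[OF FN], rotated])
        (rule N.resolution_comp_zero[OF FN])
    then have ex: "\<exists>w\<in>vecs M (c (Suc (Suc n'))). u = mat_act M (d' (Suc (Suc n'))) (c (Suc (Suc n'))) (c (Suc n')) w"
      if "u \<in> vecs M (c (Suc n'))" "mat_act M (d' (Suc n')) (c (Suc n')) (c n') u = (\<lambda>_. \<zero>\<^bsub>M\<^esub>)" for u
      using that unfolding exact_pair_def n by blast
    show "Tor_vanishes R n M N"
      unfolding Tor_vanishes_def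
    proof (intro allI impI ballI)
      fix b d e u
      assume FM: "free_resolution R M b d e" and u: "u \<in> vecs N (b n)"
        "mat_act N (d n) (b n) (b (n - 1)) u = (\<lambda>_. \<zero>\<^bsub>N\<^esub>)"
      \<comment> \<open>Second balancing with the roles exchanged: the resolution of
        \<open>N\<close> is now F, and the given resolution of \<open>M\<close> is P.\<close>
      interpret NM: two_resolutions R N M c d' e' b d e
        by unfold_locales (rule FM FN)+
      show "\<exists>w\<in>vecs N (b (Suc n)). u = mat_act N (d (Suc n)) (b (Suc n)) (b n) w"
        using NM.tor_balance[OF ex, of u] u by (simp add: n)
    qed
  next
    assume ext: "Ext_vanishes R n N (pow_submod M m t)"
    show "Ext_vanishes R n N M"
      unfolding Ext_vanishes_def
    proof (intro allI impI ballI)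
      fix b d e phi
      assume F: "free_resolution R N b d e" and phi: "phi \<in> vecs M (b n)"
        "mat_tact M (d (Suc n)) (b (Suc n)) (b n) phi = (\<lambda>_. \<zero>\<^bsub>M\<^esub>)"
      have D: "mat_over R (transp (d (Suc i))) (b i) (b (Suc i))" for i
        using N.resolution_mat[OF F, of i] by (auto simp: mat_over_def transp_def)
      \<comment> \<open>Hom(-, M) reverses the arrows: in degree \<open>n\<close> the incoming map
        is the transpose of \<open>d n\<close> and the outgoing one that of
        \<open>d (Suc n)\<close>.\<close>
      have "exact_pair (pow_submod M m t) (transp (d n)) (b n') (b n) (transp (d (Suc n))) (b (Suc n))"
        using ext F unfolding Ext_vanishes_def exact_pair_def mat_tact_eq_mat_act n diff_Suc_1
        by blast
      then have "exact_pair M (transp (d n)) (b n') (b n) (transp (d (Suc n))) (b (Suc n))"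
        unfolding n
      proof (rule M.exact_pair_pow[OF D D, rotated])
        fix k i assume ki: "k < b (Suc (Suc n'))" "i < b n'"
        \<comment> \<open>Over a commutative ring the product of the transposes is the transpose of
          the product, so dd = 0 gives the complex condition here too.\<close>
        have "lincomb (ring_module R) (\<lambda>j. d (Suc (Suc n')) j k) (d (Suc n') i) (b (Suc n')) = \<zero>\<^bsub>R\<^esub>"
          using N.resolution_comp_zero[OF F ki(2,1)]
            M.lincomb_ring_comm[of "b (Suc n')" "\<lambda>j. d (Suc (Suc n')) j k" "d (Suc n') i"]
            mat_overD[OF N.resolution_mat[OF F]] ki by simp
        then show "lincomb (ring_module R) (transp (d (Suc (Suc n'))) k) (\<lambda>j. transp (d (Suc n')) j i) (b (Suc n')) = \<zero>\<^bsub>R\<^esub>"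
          by (simp add: transp_def)
      qed
      then show "\<exists>psi\<in>vecs M (b (n - 1)). phi = mat_tact M (d n) (b n) (b (n - 1)) psi"
        using phi by (simp add: exact_pair_def mat_tact_eq_mat_act n)
    qed
  qed
qed

end
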